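(* Let $r \ge 4$ be a fixed integer. For $n \ge r$, let $G(n,r,1)$ be the graph with vertex set $[n]^{(r)}$ (all $r$-element subsets of $[n]=\{1,\dots,n\}$), in which two vertices $A,B$ are adjacent if and only if $|A\cap B|=1$, and let $G_{1/2}(n,r,1)$ be the random spanning subgraph of $G(n,r,1)$ obtained by keeping each edge independently with probability $1/2$ (equivalently, deleting each edge independently with probability $1/2$). Then $$\mathbb{P}\Big[\alpha\big(G_{1/2}(n,r,1)\big)=\alpha\big(G(n,r,1)\big)\Big]\to 1 \quad\text{as } n\to\infty,$$ where $\alpha(\cdot)$ denotes the independence number. *)

theory Defs
  imports "HOL-Probability.Probability"
begin

definition kset_vertices :: "nat \<Rightarrow> nat \<Rightarrow> nat set set" where
  "kset_vertices n r = {A. A \<subseteq> {1..n} \<and> card A = r}"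

definition kset_edges :: "nat \<Rightarrow> nat \<Rightarrow> nat set set set" where
  "kset_edges n r = {{A, B} | A B. A \<in> kset_vertices n r \<and> B \<in> kset_vertices n r
                         \<and> A \<noteq> B \<and> card (A \<inter> B) = 1}"

definition indep_set :: "'a set \<Rightarrow> 'a set set \<Rightarrow> 'a set \<Rightarrow> bool" where
  "indep_set V F S \<longleftrightarrow> S \<subseteq> V \<and> (\<forall>a\<in>S. \<forall>b\<in>S. {a, b} \<notin> F)"

definition indep_num :: "'a set \<Rightarrow> 'a set set \<Rightarrow> nat" where
  "indep_num V F = Max {card S | S. indep_set V F S}"

text \<open>Random spanning subgraph G_{1/2}: each edge kept independently with probability 1/2.
  An outcome is a function from the edge set to bool (True = kept); the kept edges form the
  edge set of the random subgraph.\<close>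
definition half_random_edges :: "nat \<Rightarrow> nat \<Rightarrow> (nat set set \<Rightarrow> bool) pmf" where
  "half_random_edges n r = Pi_pmf (kset_edges n r) False (\<lambda>_. bernoulli_pmf (1/2))"

definition kept_edges :: "nat \<Rightarrow> nat \<Rightarrow> (nat set set \<Rightarrow> bool) \<Rightarrow> nat set set set" where
  "kept_edges n r \<omega> = {e \<in> kset_edges n r. \<omega> e}"

end

theory Submission
  imports Defs "HOL-Real_Asymp.Real_Asymp"
begin

text \<open>
  The sets through a fixed pair form a family of size N = C(n - 2, r - 2) that is independent in
  G(n, r, 1), so it suffices that with high probability no family F of size N + 1 is independent in
  the random subgraph. By a union bound, with high probability every family F that is independent in
  the random subgraph spans at most \<open>\<delta> n |F|\<close> edges of G(n, r, 1). Delete the members of high degree.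
  In what remains, call a triple rich if it lies in many members; a member cannot meet a rich triple
  in exactly one point, as it would have too many neighbours. Hence rich triples never meet in exactly
  one point, and apart from lower-order terms each member is a pair P together with points that each
  complete P to a rich triple (for r = 4 there is a competing structure of unions of inseparable pairs,
  which is too small by a constant factor). Counting these members forces a single pair P to dominate,
  so all but \<open>\<epsilon> n^(r - 2)\<close> members of F contain P.

  If m > 0 members miss P, a second union bound, over these members and the fewer than m sets
  through P that are not in F, shows that the former have few neighbours in F. The set U of points they
  cover then satisfies \<open>m \<ge> c |U| n^(r - 3)\<close>, while the rich-triple analysis inside U gives
  \<open>m = O(|U|^(r - 2))\<close> up to a small term. Thus |U| is of order n and m exceeds \<open>\<epsilon> n^(r - 2)\<close>, a contradiction.
\<close>

section \<open>Families of low degree in the one-intersection graph\<close>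

text \<open>Two scales govern the argument. Near-optimality only places all but
  \<open>\<epsilon> n^(r - 2)\<close> members through one pair; the exact value needs an argument at
  the scale of the \<open>m\<close> remaining members, however small \<open>m\<close> is. This is
  why families of low degree are analysed over an arbitrary finite ground set: once on
  \<open>{1..n}\<close>, with a sharp leading constant, and once on the points covered by the
  remaining members, where a constant factor may be lost. A single pair dominates because of a
  budget. The sets of points completing different pairs to rich triples are disjoint as soon as one
  of them has three points, and they avoid the inseparable points that matter. So their sizes
  \<open>l_P\<close> add up to at most \<open>n\<close>, and the sum of the
  \<open>l_P^(r - 2)\<close> is at most \<open>n\<close> times the largest
  \<open>l_P^(r - 3)\<close>; coming close to \<open>n^(r - 2)\<close> forces one \<open>l_P\<close>
  close to \<open>n\<close>. Families of \<open>s\<close> vertices number at most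
  \<open>n^(r s)\<close>, so \<open>\<delta> n s\<close> forbidden edges beat the union bound. Of
  the star only the missing part is enumerated; the part present would be unaffordable.\<close>

lemma binomial_le_power: "n choose k \<le> n ^ k"
  by (cases "k \<le> n") (auto intro: binomial_le_pow simp: binomial_eq_0)

lemma card_supersets:
  assumes "finite V" "K \<subseteq> V" "card K \<le> r"
  shows "card {A. A \<subseteq> V \<and> card A = r \<and> K \<subseteq> A} = (card V - card K) choose (r - card K)"
proof -
  have fK: "finite K" using assms finite_subset by blast
  have "bij_betw (\<lambda>B. B \<union> K) {B. B \<subseteq> V - K \<and> card B = r - card K}
          {A. A \<subseteq> V \<and> card A = r \<and> K \<subseteq> A}"
  proof (rule bij_betw_byWitness[where f' = "\<lambda>A. A - K"])
    show "(\<lambda>B. B \<union> K) ` {B. B \<subseteq> V - K \<and> card B = r - card K}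
        \<subseteq> {A. A \<subseteq> V \<and> card A = r \<and> K \<subseteq> A}"
    proof safe
      fix B assume B: "B \<subseteq> V - K" "card B = r - card K"
      have "finite B" using B assms finite_subset by blast
      then show "card (B \<union> K) = r"
        using B assms fK by (subst card_Un_disjoint) auto
    qed (use assms in auto)
    show "(\<lambda>A. A - K) ` {A. A \<subseteq> V \<and> card A = r \<and> K \<subseteq> A}
        \<subseteq> {B. B \<subseteq> V - K \<and> card B = r - card K}"
      using fK by (auto simp: card_Diff_subset)
  qed auto
  then have "card {A. A \<subseteq> V \<and> card A = r \<and> K \<subseteq> A} = card {B. B \<subseteq> V - K \<and> card B = r - card K}"
    by (simp add: bij_betw_same_card)
  also have "\<dots> = card (V - K) choose (r - card K)"
    using assms by (simp add: n_subsets)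
  finally show ?thesis using assms fK by (simp add: card_Diff_subset)
qed

lemma card_le_of_cover:
  assumes "finite I" "S \<subseteq> (\<Union>i\<in>I. f i)" "\<And>i. i \<in> I \<Longrightarrow> finite (f i)"
    "\<And>i. i \<in> I \<Longrightarrow> card (f i) \<le> b"
  shows "card S \<le> card I * b"
proof -
  have "card S \<le> card (\<Union>i\<in>I. f i)" using assms by (intro card_mono) auto
  also have "\<dots> \<le> (\<Sum>i\<in>I. card (f i))" by (rule card_UN_le[OF assms(1)])
  also have "\<dots> \<le> card I * b" using sum_bounded_above[of I "\<lambda>i. card (f i)" b] assms by auto
  finally show ?thesis .
qed

lemma card_ge_2_subset:
  assumes "2 \<le> card S" "x \<in> S"
  obtains y where "y \<in> S" "y \<noteq> x"
  using assms by (metis card_1_singleton_iff card_le_Suc0_iff_eq card.infinite not_less_eq_eq numeral_2_eq_2 zero_le)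

text \<open>At most \<open>r * card V ^ (r - 4)\<close> members through a triple meet a given set of
  at most \<open>r\<close> further points. The condition on \<open>D\<close> thus says that among
  \<open>D\<close> members through a triple more than \<open>\<Delta>\<close> avoid such a
  set.\<close>

locale sparse_family =
  fixes V :: "'a set" and r :: nat and X :: "'a set set" and \<Delta> D :: nat
  assumes finV: "finite V" and r4: "4 \<le> r"
    and X_sub: "X \<subseteq> {A. A \<subseteq> V \<and> card A = r}"
    and deg: "\<And>A. A \<in> X \<Longrightarrow> card {B \<in> X. card (A \<inter> B) = 1} \<le> \<Delta>"
    and D: "\<Delta> + r * card V ^ (r - 4) < D"
begin

lemma finX: "finite X"
  using X_sub finV by (metis (no_types, lifting) Collect_mono_iff finite_Collect_subsets finite_subset)

lemma X_D: "A \<in> X \<Longrightarrow> A \<subseteq> V" "A \<in> X \<Longrightarrow> card A = r" "A \<in> X \<Longrightarrow> finite A"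
  using X_sub finV finite_subset by blast+

lemma finsub: "finite {A \<in> X. P A}"
  using finX by simp

lemma card_containing:
  assumes "finite K" "card K \<le> r"
  shows "card {A \<in> X. K \<subseteq> A} \<le> card V ^ (r - card K)"
proof (cases "K \<subseteq> V")
  case True
  have "card {A \<in> X. K \<subseteq> A} \<le> card {A. A \<subseteq> V \<and> card A = r \<and> K \<subseteq> A}"
    using X_sub finV by (intro card_mono) auto
  also have "\<dots> = (card V - card K) choose (r - card K)"
    by (rule card_supersets) (use finV True assms in auto)
  also have "\<dots> \<le> (card V - card K) ^ (r - card K)" by (rule binomial_le_power)
  also have "\<dots> \<le> card V ^ (r - card K)" by (intro power_mono) auto
  finally show ?thesis .
next
  case False
  then have "{A \<in> X. K \<subseteq> A} = {}" using X_D by blast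
  then have "card {A \<in> X. K \<subseteq> A} = 0" by (simp only: card.empty)
  then show ?thesis by linarith
qed

section \<open>Rich triples: intersections and number\<close>

definition rich :: "'a set \<Rightarrow> bool" where
  "rich T \<longleftrightarrow> card T = 3 \<and> D \<le> card {A \<in> X. T \<subseteq> A}"

lemma D_pos: "0 < D" using D by simp

lemma rich_D: "rich T \<Longrightarrow> card T = 3" "rich T \<Longrightarrow> finite T"
  unfolding rich_def by (auto intro: card_ge_0_finite)

lemma rich_ex: "rich T \<Longrightarrow> \<exists>A\<in>X. T \<subseteq> A"
  using D_pos unfolding rich_def by (metis (mono_tags, lifting) card.empty empty_Collect_eq leD)

lemma rich_subV: "rich T \<Longrightarrow> T \<subseteq> V"
  using rich_ex X_D by blast

text \<open>If \<open>A\<close> met \<open>T\<close> in one point, every member through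
  \<open>T\<close> avoiding \<open>A - T\<close> would be a neighbour of \<open>A\<close>, and there
  are more than \<open>\<Delta>\<close> of them.\<close>

lemma rich_meet:
  assumes T: "rich T" and A: "A \<in> X"
  shows "card (A \<inter> T) \<noteq> 1"
proof
  assume "card (A \<inter> T) = 1"
  then obtain v where v: "A \<inter> T = {v}" by (auto simp: card_1_singleton_iff)
  have fA: "finite A" "card A = r" using A X_D by auto
  have sub: "{B \<in> X. T \<subseteq> B} \<subseteq> {B \<in> X. card (A \<inter> B) = 1} \<union> (\<Union>w\<in>A - T. {B \<in> X. insert w T \<subseteq> B})"
  proof
    fix B assume B: "B \<in> {B \<in> X. T \<subseteq> B}"
    show "B \<in> {B \<in> X. card (A \<inter> B) = 1} \<union> (\<Union>w\<in>A - T. {B \<in> X. insert w T \<subseteq> B})"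
    proof (cases "(A - T) \<inter> B = {}")
      case True
      then have "A \<inter> B = {v}" using v B by auto
      then show ?thesis using B by auto
    qed (use B in auto)
  qed
  have "card (\<Union>w\<in>A - T. {B \<in> X. insert w T \<subseteq> B}) \<le> card (A - T) * card V ^ (r - 4)"
  proof (rule card_le_of_cover)
    fix w assume w: "w \<in> A - T"
    have c: "card (insert w T) = 4" using w rich_D[OF T] by simp
    show "card {B \<in> X. insert w T \<subseteq> B} \<le> card V ^ (r - 4)"
      using card_containing[of "insert w T"] c r4 rich_D[OF T] by simp
  qed (use fA finX in auto)
  also have "\<dots> \<le> r * card V ^ (r - 4)"
    using fA by (intro mult_right_mono) (auto intro: card_mono)
  finally have 2: "card (\<Union>w\<in>A - T. {B \<in> X. insert w T \<subseteq> B}) \<le> r * card V ^ (r - 4)" .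
  have "D \<le> card {B \<in> X. T \<subseteq> B}" using T by (simp add: rich_def)
  also have "\<dots> \<le> card ({B \<in> X. card (A \<inter> B) = 1} \<union> (\<Union>w\<in>A - T. {B \<in> X. insert w T \<subseteq> B}))"
    using finX fA by (intro card_mono sub) auto
  also have "\<dots> \<le> card {B \<in> X. card (A \<inter> B) = 1} + card (\<Union>w\<in>A - T. {B \<in> X. insert w T \<subseteq> B})"
    by (rule card_Un_le)
  also have "\<dots> \<le> \<Delta> + r * card V ^ (r - 4)" using deg[OF A] 2 by simp
  finally show False using D by simp
qed

text \<open>Some member through \<open>T'\<close> avoids \<open>T - T'\<close>; if the triples
  shared exactly one point, this member would contradict \<open>rich_meet\<close> for
  \<open>T\<close>.\<close>

lemma rich_rich_meet:
  assumes T: "rich T" and T': "rich T'"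
  shows "card (T \<inter> T') \<noteq> 1"
proof
  assume "card (T \<inter> T') = 1"
  then obtain v where v: "T \<inter> T' = {v}" by (auto simp: card_1_singleton_iff)
  have fT: "finite T" "card T = 3" "finite T'" "card T' = 3" using T T' rich_D by auto
  have "card (\<Union>w\<in>T - T'. {B \<in> X. insert w T' \<subseteq> B}) \<le> card (T - T') * card V ^ (r - 4)"
  proof (rule card_le_of_cover)
    fix w assume w: "w \<in> T - T'"
    have c: "card (insert w T') = 4" using w fT by simp
    show "card {B \<in> X. insert w T' \<subseteq> B} \<le> card V ^ (r - 4)"
      using card_containing[of "insert w T'"] c r4 fT by simp
  qed (use fT finX in auto)
  also have "\<dots> \<le> r * card V ^ (r - 4)"
    using fT r4 card_mono[of T "T - T'"] by (intro mult_right_mono) auto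
  also have "\<dots> < D" using D by simp
  also have "D \<le> card {B \<in> X. T' \<subseteq> B}" using T' by (simp add: rich_def)
  finally have lt: "card (\<Union>w\<in>T - T'. {B \<in> X. insert w T' \<subseteq> B}) < card {B \<in> X. T' \<subseteq> B}" .
  have "finite (\<Union>w\<in>T - T'. {B \<in> X. insert w T' \<subseteq> B})" using fT finX by auto
  from card_mono[OF this, of "{B \<in> X. T' \<subseteq> B}"] lt
  have "\<not> {B \<in> X. T' \<subseteq> B} \<subseteq> (\<Union>w\<in>T - T'. {B \<in> X. insert w T' \<subseteq> B})" by linarith
  then obtain B where B: "B \<in> X" "T' \<subseteq> B" "\<forall>w\<in>T - T'. w \<notin> B" by auto
  then have "B \<inter> T = {v}" using v by auto
  then show False using rich_meet[OF T B(1)] by simp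
qed

definition num_rich :: nat where "num_rich = card {T. rich T}"

lemma fin_rich: "finite {T. rich T}"
  using rich_subV finV by (metis (no_types, lifting) finite_Collect_subsets finite_subset mem_Collect_eq subsetI)

text \<open>Fix one rich triple \<open>S u\<close> through each covered point \<open>u\<close>. Any
  rich triple through \<open>u\<close> shares a second point with \<open>S u\<close>, so it is given
  by \<open>u\<close>, one of at most three points of \<open>S u\<close>, and a free third
  point.\<close>

lemma num_rich_quadratic: "num_rich \<le> 3 * card V ^ 2"
proof -
  define S where "S u = (SOME T. rich T \<and> u \<in> T)" for u
  have S: "rich (S u) \<and> u \<in> S u" if "rich T" "u \<in> T" for u T
    unfolding S_def by (rule someI[of _ T]) (use that in auto)
  define I where "I = (SIGMA u : {u\<in>V. \<exists>T. rich T \<and> u \<in> T}. S u)"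
  have fI: "finite I" unfolding I_def using finV S rich_D by (intro finite_SigmaI) auto
  have "card I \<le> card V * 3"
  proof -
    have "card I \<le> card {u\<in>V. \<exists>T. rich T \<and> u \<in> T} * 3"
    proof -
      have "finite (S u)" "card (S u) \<le> 3" if "u \<in> {u\<in>V. \<exists>T. rich T \<and> u \<in> T}" for u
        using that S rich_D by fastforce+
      then show ?thesis
        unfolding I_def using finV
          sum_bounded_above[of "{u\<in>V. \<exists>T. rich T \<and> u \<in> T}" "\<lambda>u. card (S u)" 3]
        by (subst card_SigmaI) auto
    qed
    also have "\<dots> \<le> card V * 3" using finV by (intro mult_right_mono card_mono) auto
    finally show ?thesis .
  qed
  moreover have "num_rich \<le> card (I \<times> V)"
    unfolding num_rich_def
  proof (rule surj_card_le)
    show "finite (I \<times> V)" using fI finV by auto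
    show "{T. rich T} \<subseteq> (\<lambda>((u, v), w). {u, v, w}) ` (I \<times> V)"
    proof safe
      fix T assume T: "rich T"
      then obtain u where u: "u \<in> T" using rich_D[OF T] by fastforce
      have S': "rich (S u)" "u \<in> S u" using S[OF T u] by auto
      have "u \<in> V" using u rich_subV[OF T] by auto
      have "card (T \<inter> S u) \<noteq> 1" by (rule rich_rich_meet[OF T S'(1)])
      moreover have "card (T \<inter> S u) \<noteq> 0" using u S' rich_D[OF T] by auto
      ultimately have "2 \<le> card (T \<inter> S u)" by linarith
      then obtain v where v: "v \<in> T" "v \<in> S u" "v \<noteq> u"
        using card_ge_2_subset[of "T \<inter> S u" u] u S' by auto
      have "card (T - {u, v}) = 1" using u v rich_D[OF T] by (simp add: card_Diff_subset)
      then obtain w where "T - {u, v} = {w}" by (auto simp: card_1_singleton_iff)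
      then have w: "T = {u, v, w}" "w \<in> V" using u v rich_subV[OF T] by auto
      have "((u, v), w) \<in> I \<times> V" using w v u T \<open>u \<in> V\<close> by (auto simp: I_def)
      then show "T \<in> (\<lambda>((u, v), w). {u, v, w}) ` (I \<times> V)" using w by force
    qed
  qed
  moreover have "card (I \<times> V) = card I * card V" by (rule card_cartesian_product)
  ultimately have "num_rich \<le> (card V * 3) * card V" by (metis mult_le_mono1 order_trans)
  then show ?thesis by (simp add: power2_eq_square)
qed

text \<open>Double counting of pairs (rich triple, member above it). For \<open>card X\<close> of
  order \<open>n^(r - 2)\<close> and \<open>D\<close> of order \<open>n^(r - 3)\<close> the number
  of rich triples becomes linear in \<open>n\<close>, which makes the error terms of the stability
  argument lower-order.\<close>

lemma num_rich_mult_D: "num_rich * D \<le> r ^ 3 * card X"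
proof -
  let ?P = "SIGMA T : {T. rich T}. {A \<in> X. T \<subseteq> A}"
  let ?Q = "SIGMA A : X. {T. rich T \<and> T \<subseteq> A}"
  have "num_rich * D \<le> (\<Sum>T | rich T. card {A \<in> X. T \<subseteq> A})"
  proof -
    have "D \<le> card {A \<in> X. T \<subseteq> A}" if "T \<in> {T. rich T}" for T
      using that by (simp add: rich_def)
    then show ?thesis
      using sum_bounded_below[of "{T. rich T}" D "\<lambda>T. card {A \<in> X. T \<subseteq> A}"] by (simp add: num_rich_def)
  qed
  also have "\<dots> = card ?P" using fin_rich finX by (subst card_SigmaI) auto
  also have "\<dots> = card ?Q"
    by (rule bij_betw_same_card[of prod.swap], rule bij_betw_byWitness[where f' = prod.swap]) auto
  also have "\<dots> = (\<Sum>A\<in>X. card {T. rich T \<and> T \<subseteq> A})"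
    using fin_rich finX by (subst card_SigmaI) auto
  also have "\<dots> \<le> card X * r ^ 3"
  proof (rule sum_bounded_above[where K = "r ^ 3", simplified])
    fix A assume A: "A \<in> X"
    have "card {T. rich T \<and> T \<subseteq> A} \<le> card {T. T \<subseteq> A \<and> card T = 3}"
      using X_D[OF A] by (intro card_mono) (auto simp: rich_def)
    also have "\<dots> = r choose 3" using n_subsets X_D[OF A] by metis
    also have "\<dots> \<le> r ^ 3" by (rule binomial_le_power)
    finally show "card {T. rich T \<and> T \<subseteq> A} \<le> r ^ 3" .
  qed
  finally show ?thesis by (simp add: mult.commute)
qed


section \<open>Points of a member that no rich triple inside it covers\<close>

definition bad :: "'a \<Rightarrow> 'a set \<Rightarrow> bool" where
  "bad u A \<longleftrightarrow> A \<in> X \<and> u \<in> A \<and> \<not> (\<exists>T. rich T \<and> u \<in> T \<and> T \<subseteq> A)"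

text \<open>The exceptions of \<open>cover_by_pairs\<close>, plus \<open>D\<close> for each of its
  at most \<open>r ^ 2\<close> pairs once the pair is extended to a triple.\<close>

definition bad_bound :: nat where "bad_bound = r * \<Delta> + r ^ 2 * D"

definition uncommitted :: "'a \<Rightarrow> bool" where
  "uncommitted u \<longleftrightarrow> (\<forall>a. a \<noteq> u \<longrightarrow> (\<exists>A\<in>X. u \<in> A \<and> a \<notin> A))"

lemma fin_bad: "finite {A. bad u A}" "finite {A. bad u A \<and> P A}"
  using finX by (auto simp: bad_def)

text \<open>The members through \<open>u\<close> are almost pairwise intersecting outside \<open>u\<close>, and they have no common
  further point, so two of them already give a small transversal by pairs.\<close>

lemma cover_by_pairs:
  assumes u: "uncommitted u"
  obtains Q where "finite Q" "card Q \<le> r ^ 2" "\<forall>b c. (b, c) \<in> Q \<longrightarrow> b \<noteq> c \<and> b \<noteq> u \<and> c \<noteq> u"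
    "card {A \<in> X. u \<in> A \<and> \<not> (\<exists>(b, c)\<in>Q. b \<in> A \<and> c \<in> A)} \<le> r * \<Delta>"
proof (cases "\<exists>A\<in>X. u \<in> A")
  case False
  then have "{A \<in> X. u \<in> A \<and> \<not> (\<exists>(b, c)\<in>{}. b \<in> A \<and> c \<in> A)} = {}" by blast
  then have "card {A \<in> X. u \<in> A \<and> \<not> (\<exists>(b, c)\<in>{}. b \<in> A \<and> c \<in> A)} \<le> r * \<Delta>"
    by (simp only: card.empty)
  then show ?thesis using that[of "{}"] by simp
next
  case True
  then obtain A0 where A0: "A0 \<in> X" "u \<in> A0" by blast
  define B where "B a = (SOME A. A \<in> X \<and> u \<in> A \<and> a \<notin> A)" for a
  have B: "B a \<in> X \<and> u \<in> B a \<and> a \<notin> B a" if "a \<noteq> u" for a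
    unfolding B_def by (rule someI_ex) (use u that in \<open>auto simp: uncommitted_def\<close>)
  have cA: "card A0 = r" "finite A0" using X_D A0 by auto
  define Q where "Q = (SIGMA a : A0 - {u}. B a - {u})"
  \<comment> \<open>The index \<open>u\<close> is free, as \<open>B\<close> is only used on
    \<open>A0 - {u}\<close>; giving it to \<open>A0\<close> itself makes every exception a neighbour
    of one of exactly \<open>r\<close> members.\<close>
  define B' where "B' i = (if i = u then A0 else B i)" for i
  have B': "B' i \<in> X" for i using B A0 by (auto simp: B'_def)
  have fin: "finite (B a - {u})" "card (B a - {u}) \<le> r" if "a \<in> A0 - {u}" for a
    using B[of a] that X_D card_mono[of "B a" "B a - {u}"] by auto
  show ?thesis
  proof (rule that[of Q])
    show "finite Q" using fin cA by (auto simp: Q_def)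
    have "card Q \<le> card (A0 - {u}) * r"
      using fin cA sum_bounded_above[of "A0 - {u}" "\<lambda>a. card (B a - {u})" r]
      by (simp add: Q_def card_SigmaI)
    also have "\<dots> \<le> r * r" using cA by (intro mult_right_mono) (auto intro: card_mono)
    finally show "card Q \<le> r ^ 2" by (simp add: power2_eq_square)
    show "\<forall>b c. (b, c) \<in> Q \<longrightarrow> b \<noteq> c \<and> b \<noteq> u \<and> c \<noteq> u"
      using B by (auto simp: Q_def)
    have "card {A \<in> X. u \<in> A \<and> \<not> (\<exists>(b, c)\<in>Q. b \<in> A \<and> c \<in> A)} \<le> card A0 * \<Delta>"
    proof (rule card_le_of_cover[where f = "\<lambda>i. {A \<in> X. card (B' i \<inter> A) = 1}"])
      show "{A \<in> X. u \<in> A \<and> \<not> (\<exists>(b, c)\<in>Q. b \<in> A \<and> c \<in> A)} \<subseteq> (\<Union>i\<in>A0. {A \<in> X. card (B' i \<inter> A) = 1})"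
      proof safe
        fix A assume A: "A \<in> X" "u \<in> A" "\<not> (\<exists>(b, c)\<in>Q. b \<in> A \<and> c \<in> A)"
        show "A \<in> (\<Union>i\<in>A0. {A \<in> X. card (B' i \<inter> A) = 1})"
        proof (cases "A0 \<inter> A = {u}")
          case True
          then show ?thesis using A A0 by (intro UN_I[of u]) (auto simp: B'_def)
        next
          case False
          then obtain a where a: "a \<in> A0" "a \<in> A" "a \<noteq> u" using A0 A by auto
          have "B a \<inter> A = {u}" using A(2,3) a B[of a] by (auto simp: Q_def)
          then show ?thesis using A a by (intro UN_I[of a]) (auto simp: B'_def)
        qed
      qed
    qed (use cA finX deg B' in auto)
    then show "card {A \<in> X. u \<in> A \<and> \<not> (\<exists>(b, c)\<in>Q. b \<in> A \<and> c \<in> A)} \<le> r * \<Delta>"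
      using cA by simp
  qed
qed

lemma card_bad_triple:
  assumes "card T = 3" "u \<in> T"
  shows "card {A. bad u A \<and> T \<subseteq> A} \<le> D"
proof (cases "rich T")
  case True
  then have "{A. bad u A \<and> T \<subseteq> A} = {}" using assms by (auto simp: bad_def)
  then have "card {A. bad u A \<and> T \<subseteq> A} = 0" by (simp only: card.empty)
  then show ?thesis by linarith
next
  case False
  have "card {A. bad u A \<and> T \<subseteq> A} \<le> card {A \<in> X. T \<subseteq> A}"
    using finX by (intro card_mono) (auto simp: bad_def)
  then show ?thesis using False assms by (auto simp: rich_def)
qed

text \<open>The pair cover belongs to \<open>a\<close>. With \<open>a = u\<close> this treats
  uncommitted points; with \<open>a \<noteq> u\<close> it treats points that always occur together
  with an uncommitted one.\<close>

lemma card_bad_uncommitted: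
  assumes a: "uncommitted a" and ua: "\<And>A. A \<in> X \<Longrightarrow> u \<in> A \<Longrightarrow> a \<in> A"
  shows "card {A. bad u A} \<le> bad_bound"
proof -
  obtain Q where Q: "finite Q" "card Q \<le> r ^ 2" "\<forall>b c. (b, c) \<in> Q \<longrightarrow> b \<noteq> c \<and> b \<noteq> a \<and> c \<noteq> a"
    "card {A \<in> X. a \<in> A \<and> \<not> (\<exists>(b, c)\<in>Q. b \<in> A \<and> c \<in> A)} \<le> r * \<Delta>"
    using cover_by_pairs[OF a] by blast
  \<comment> \<open>A triple through \<open>u\<close> inside every member that contains
    \<open>u\<close>, \<open>a\<close> and the pair; the cases avoid a repeated point when
    \<open>a = u\<close> or when the pair contains \<open>u\<close>.\<close>
  define t where "t q = (if a = u then {u, fst q, snd q}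
     else if fst q = u then {u, a, snd q} else {u, a, fst q})" for q
  have t: "card (t q) = 3 \<and> u \<in> t q" if "q \<in> Q" for q
    using Q(3)[rule_format, of "fst q" "snd q"] that by (auto simp: t_def)
  let ?exc = "{A \<in> X. a \<in> A \<and> \<not> (\<exists>(b, c)\<in>Q. b \<in> A \<and> c \<in> A)}"
  have sub: "{A. bad u A} \<subseteq> ?exc \<union> (\<Union>q\<in>Q. {A. bad u A \<and> t q \<subseteq> A})"
  proof
    fix A assume "A \<in> {A. bad u A}"
    then have A: "bad u A" "A \<in> X" "u \<in> A" "a \<in> A" using ua by (auto simp: bad_def)
    show "A \<in> ?exc \<union> (\<Union>q\<in>Q. {A. bad u A \<and> t q \<subseteq> A})"
    proof (cases "\<exists>(b, c)\<in>Q. b \<in> A \<and> c \<in> A")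
      case True
      then obtain q where "q \<in> Q" "fst q \<in> A" "snd q \<in> A" by auto
      then have "q \<in> Q" "bad u A \<and> t q \<subseteq> A" using A by (auto simp: t_def)
      then show ?thesis by blast
    qed (use A in auto)
  qed
  have "card (\<Union>q\<in>Q. {A. bad u A \<and> t q \<subseteq> A}) \<le> card Q * D"
    by (rule card_le_of_cover[where f = "\<lambda>q. {A. bad u A \<and> t q \<subseteq> A}"])
      (use Q(1) fin_bad card_bad_triple t in auto)
  also have "\<dots> \<le> r ^ 2 * D" using Q by (intro mult_right_mono) auto
  finally have 2: "card (\<Union>q\<in>Q. {A. bad u A \<and> t q \<subseteq> A}) \<le> r ^ 2 * D" .
  have "card {A. bad u A} \<le> card (?exc \<union> (\<Union>q\<in>Q. {A. bad u A \<and> t q \<subseteq> A}))"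
    using finX Q fin_bad by (intro card_mono sub) auto
  also have "\<dots> \<le> card ?exc + card (\<Union>q\<in>Q. {A. bad u A \<and> t q \<subseteq> A})" by (rule card_Un_le)
  finally show ?thesis using 2 Q(4) by (simp add: bad_bound_def)
qed

lemma D_le_bad_bound: "D \<le> bad_bound"
proof -
  have "1 * D \<le> r ^ 2 * D" using r4 by (intro mult_right_mono) auto
  then show ?thesis unfolding bad_bound_def by linarith
qed

lemma card_bad_triple_all:
  assumes "\<And>A. A \<in> X \<Longrightarrow> u \<in> A \<Longrightarrow> a \<in> A \<and> b \<in> A" "u \<noteq> a" "u \<noteq> b" "a \<noteq> b"
  shows "card {A. bad u A} \<le> bad_bound"
proof -
  have "bad u A \<longleftrightarrow> bad u A \<and> {u, a, b} \<subseteq> A" for A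
    using assms(1)[of A] by (auto simp: bad_def)
  then have "{A. bad u A} = {A. bad u A \<and> {u, a, b} \<subseteq> A}" by blast
  moreover have "card {A. bad u A \<and> {u, a, b} \<subseteq> A} \<le> D"
    by (rule card_bad_triple) (use assms(2-) in auto)
  ultimately show ?thesis using D_le_bad_bound by (metis order_trans)
qed

definition partner :: "'a \<Rightarrow> 'a \<Rightarrow> bool" where
  "partner u a \<longleftrightarrow> a \<noteq> u \<and> (\<forall>A\<in>X. u \<in> A \<longleftrightarrow> a \<in> A)"

text \<open>If \<open>u\<close> always brings \<open>a\<close> and \<open>a\<close> always brings
  \<open>b\<close>, then either \<open>b = u\<close> and the two are inseparable, or the fixed
  triple \<open>{u, a, b}\<close> lies in all members through \<open>u\<close>. If the chain stops
  earlier, it stops at an uncommitted point.\<close>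

lemma few_bad_or_partner: "card {A. bad u A} \<le> bad_bound \<or> (\<exists>a. partner u a)"
proof (cases "uncommitted u")
  case True
  then show ?thesis using card_bad_uncommitted[of u u] by auto
next
  case False
  then obtain a where a: "a \<noteq> u" "\<And>A. A \<in> X \<Longrightarrow> u \<in> A \<Longrightarrow> a \<in> A" by (auto simp: uncommitted_def)
  show ?thesis
  proof (cases "uncommitted a")
    case True
    then show ?thesis using card_bad_uncommitted[of a u] a by auto
  next
    case False
    then obtain b where b: "b \<noteq> a" "\<And>A. A \<in> X \<Longrightarrow> a \<in> A \<Longrightarrow> b \<in> A" by (auto simp: uncommitted_def)
    show ?thesis
    proof (cases "b = u")
      case True
      then show ?thesis using a b unfolding partner_def by blast
    next
      case False
      have "card {A. bad u A} \<le> bad_bound"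
        by (rule card_bad_triple_all[of u a b]) (use a b False in blast)+
      then show ?thesis by blast
    qed
  qed
qed

section \<open>Inseparable pairs of points\<close>

text \<open>Defined by having many bad members, so that all other points are harmless. A partner
  then exists by \<open>few_bad_or_partner\<close>, and is unique since two partners would put a
  fixed triple into all members through the point.\<close>

definition paired :: "'a set" where "paired = {u. bad_bound < card {A. bad u A}}"

lemma paired_ex: "u \<in> paired \<Longrightarrow> \<exists>A. bad u A"
  unfolding paired_def by (metis (mono_tags, lifting) Collect_empty_eq card.empty mem_Collect_eq not_less_zero)

lemma paired_sub: "paired \<subseteq> V"
proof
  fix u assume "u \<in> paired"
  then obtain A where "bad u A" using paired_ex by blast
  then show "u \<in> V" using X_D by (auto simp: bad_def)
qed

lemma fin_paired: "finite paired" using paired_sub finV finite_subset by blast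

lemma partner_unique: "u \<in> paired \<Longrightarrow> partner u a \<Longrightarrow> partner u b \<Longrightarrow> a = b"
proof (rule ccontr)
  assume u: "u \<in> paired" and ab: "partner u a" "partner u b" "a \<noteq> b"
  have "card {A. bad u A} \<le> bad_bound"
    by (rule card_bad_triple_all[of u a b]) (use ab in \<open>unfold partner_def, blast\<close>)+
  then show False using u by (simp add: paired_def)
qed

definition mate :: "'a \<Rightarrow> 'a" where "mate u = (SOME a. partner u a)"

lemma mate: "u \<in> paired \<Longrightarrow> partner u (mate u)"
proof -
  assume "u \<in> paired"
  then have "\<not> card {A. bad u A} \<le> bad_bound" by (simp add: paired_def)
  then have "\<exists>a. partner u a" using few_bad_or_partner by blast
  then show ?thesis unfolding mate_def by (rule someI_ex)
qed

lemma partner_sym: "partner u a \<Longrightarrow> partner a u"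
  unfolding partner_def by blast

text \<open>Members through \<open>T\<close> contain \<open>a\<close>, hence \<open>u\<close>. So
  for another point \<open>b\<close> of \<open>T\<close> the triple \<open>{u, a, b}\<close> lies in
  at least as many members as \<open>T\<close>.\<close>

lemma rich_swap:
  assumes T: "rich T" "a \<in> T" and ua: "partner u a" and A: "A \<in> X" "T \<subseteq> A"
  obtains T' where "rich T'" "u \<in> T'" "T' \<subseteq> A" "T' \<subseteq> insert u T"
proof (cases "u \<in> T")
  case False
  have fT: "finite T" "card T = 3" using rich_D T by auto
  then have "card (T - {a}) = 2" using T by simp
  then have "T - {a} \<noteq> {}" by (metis card.empty zero_neq_numeral)
  then obtain b where b: "b \<in> T" "b \<noteq> a" by blast
  have "a \<noteq> u" using ua unfolding partner_def by blast
  moreover have "b \<noteq> u" using b False by blast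
  ultimately have "card {u, a, b} = 3" using b by simp
  moreover have "{A \<in> X. T \<subseteq> A} \<subseteq> {A \<in> X. {u, a, b} \<subseteq> A}"
    using b T ua unfolding partner_def by blast
  then have "D \<le> card {A \<in> X. {u, a, b} \<subseteq> A}"
    using card_mono[OF finsub] T unfolding rich_def by (meson order_trans)
  ultimately have "rich {u, a, b}" by (simp add: rich_def)
  moreover have "{u, a, b} \<subseteq> A" using b T A ua unfolding partner_def by blast
  ultimately show ?thesis using that[of "{u, a, b}"] b T by auto
qed (use assms that in auto)

lemma bad_partner:
  assumes ua: "partner u a" and bad: "bad u A"
  shows "bad a A"
proof -
  have A: "A \<in> X" "u \<in> A" "\<not> (\<exists>T. rich T \<and> u \<in> T \<and> T \<subseteq> A)"
    using bad unfolding bad_def by blast+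
  have "a \<in> A" using ua A(1,2) unfolding partner_def by blast
  moreover have False if T: "rich T" "a \<in> T" "T \<subseteq> A" for T
  proof (rule rich_swap[OF T(1,2) ua A(1) T(3)])
    fix T' assume "rich T'" "u \<in> T'" "T' \<subseteq> A"
    then show False using A(3) by blast
  qed
  ultimately show ?thesis using A(1) unfolding bad_def by blast
qed

lemma mate_paired: assumes "u \<in> paired" shows "mate u \<in> paired"
proof -
  have "bad u A = bad (mate u) A" for A
    using mate[OF assms] bad_partner partner_sym by blast
  then have "bad u = bad (mate u)" by blast
  then show ?thesis using assms by (simp add: paired_def)
qed

lemma mate_mate: "u \<in> paired \<Longrightarrow> mate (mate u) = u"
  using mate mate_paired partner_sym partner_unique by blast

lemma mate_neq: "u \<in> paired \<Longrightarrow> mate u \<noteq> u"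
  using mate unfolding partner_def by blast

lemma mate_mem: "u \<in> paired \<Longrightarrow> A \<in> X \<Longrightarrow> mate u \<in> A \<longleftrightarrow> u \<in> A"
  using mate unfolding partner_def by blast

section \<open>Exceptional classes of lower order\<close>

definition poorly_covered :: "'a set set" where "poorly_covered = {A \<in> X. \<exists>u\<in>V - paired. bad u A}"

lemma card_poorly_covered: "card poorly_covered \<le> card V * bad_bound"
proof -
  have "card (\<Union>u\<in>V - paired. {A. bad u A}) \<le> card (V - paired) * bad_bound"
  proof (rule card_le_of_cover[OF _ subset_refl])
    show "finite (V - paired)" using finV by simp
    show "finite {A. bad u A}" for u by (rule fin_bad)
    show "card {A. bad u A} \<le> bad_bound" if "u \<in> V - paired" for u
      using that by (simp add: paired_def)
  qed
  moreover have "poorly_covered \<subseteq> (\<Union>u\<in>V - paired. {A. bad u A})" by (auto simp: poorly_covered_def)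
  then have "card poorly_covered \<le> card (\<Union>u\<in>V - paired. {A. bad u A})"
    by (rule card_mono[rotated]) (simp add: finV fin_bad(1))
  moreover have "card (V - paired) * bad_bound \<le> card V * bad_bound"
    by (intro mult_le_mono1 card_mono finV Diff_subset)
  ultimately show ?thesis by linarith
qed


lemma rich_mono:
  assumes "rich T" "card T' = 3" "\<And>A. A \<in> X \<Longrightarrow> T \<subseteq> A \<Longrightarrow> T' \<subseteq> A"
  shows "rich T'"
proof -
  have "card {A \<in> X. T \<subseteq> A} \<le> card {A \<in> X. T' \<subseteq> A}"
    by (rule card_mono[OF finsub]) (use assms(3) in blast)
  then show ?thesis using assms(1,2) by (simp add: rich_def)
qed

definition rich_and_paired :: "'a set set" where
  "rich_and_paired = {A \<in> X. \<exists>u T. u \<in> paired \<and> bad u A \<and> rich T \<and> T \<subseteq> A}"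

text \<open>Inside such a member neither \<open>u\<close> nor \<open>mate u\<close> lies in a rich
  triple, so \<open>T\<close> and the mate pair make five points. Only \<open>T\<close> and
  \<open>u\<close> are chosen: the mate comes for free and saves a factor
  \<open>card V\<close>.\<close>

lemma card_rich_and_paired: "card rich_and_paired \<le> num_rich * card V ^ (r - 4)"
proof (cases "rich_and_paired = {}")
  case False
  have key: "card (T \<union> {u, mate u}) = 5 \<and> T \<union> {u, mate u} \<subseteq> A"
    if "A \<in> X" "u \<in> paired" "bad u A" "rich T" "T \<subseteq> A" for A u T
  proof -
    have "u \<notin> T" using that by (auto simp: bad_def)
    moreover have "bad (mate u) A" using bad_partner[OF mate that(3)] that by blast
    then have "mate u \<notin> T" "mate u \<in> A" using that by (auto simp: bad_def)
    moreover have "u \<in> A" using that by (simp add: bad_def)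
    ultimately show ?thesis using rich_D[OF \<open>rich T\<close>] mate_neq[OF \<open>u \<in> paired\<close>] that(5)
      by (subst card_Un_disjoint) auto
  qed
  obtain A u T where "A \<in> X" "u \<in> paired" "bad u A" "rich T" "T \<subseteq> A"
    using False unfolding rich_and_paired_def by blast
  then have r5: "5 \<le> r" using key[of A u T] X_D[of A] card_mono[of A "T \<union> {u, mate u}"] by auto
  let ?I = "{T. rich T} \<times> paired"
  let ?f = "\<lambda>(T, u). if card (T \<union> {u, mate u}) = 5 then {A \<in> X. T \<union> {u, mate u} \<subseteq> A} else {}"
  have "card rich_and_paired \<le> card ?I * card V ^ (r - 5)"
  proof (rule card_le_of_cover)
    show "finite ?I" using fin_rich fin_paired by blast
    show "rich_and_paired \<subseteq> (\<Union>i\<in>?I. ?f i)"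
    proof
      fix A assume "A \<in> rich_and_paired"
      then obtain u T where "A \<in> X" "u \<in> paired" "bad u A" "rich T" "T \<subseteq> A"
        unfolding rich_and_paired_def by blast
      then show "A \<in> (\<Union>i\<in>?I. ?f i)" using key[of A u T] by (intro UN_I[of "(T, u)"]) simp_all
    qed
    fix i assume i: "i \<in> ?I"
    show "finite (?f i)" using finX by (simp add: case_prod_beta)
    obtain T u where [simp]: "i = (T, u)" by (cases i)
    have "finite (T \<union> {u, mate u})" using i rich_D by simp
    then show "card (?f i) \<le> card V ^ (r - 5)"
      using card_containing[of "T \<union> {u, mate u}"] r5
      by (cases "card (T \<union> {u, mate u}) = 5") simp_all
  qed
  also have "\<dots> = num_rich * (card paired * card V ^ (r - 5))" by (simp add: card_cartesian_product num_rich_def)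
  also have "\<dots> \<le> num_rich * (card V * card V ^ (r - 5))"
    using finV paired_sub by (intro mult_le_mono card_mono order_refl)
  also have "card V * card V ^ (r - 5) = card V ^ (r - 4)"
    using r5 by (metis Suc_diff_le add_diff_cancel_right' diff_Suc_Suc eval_nat_numeral(3) numeral_eq_Suc power_Suc pred_numeral_simps(3))
  finally show ?thesis .
qed simp

definition disjointly_rich :: "'a set set" where
  "disjointly_rich = {A \<in> X. \<exists>T T'. rich T \<and> rich T' \<and> T \<inter> T' = {} \<and> T \<union> T' \<subseteq> A}"

text \<open>Two triples fix six points. Only one of the two factors \<open>num_rich\<close> is
  replaced by its quadratic bound, so that the other can later profit from
  \<open>num_rich_mult_D\<close>.\<close>

lemma card_disjointly_rich: "card disjointly_rich \<le> 3 * num_rich * card V ^ (r - 4)"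
proof (cases "disjointly_rich = {}")
  case False
  have key: "card (T \<union> T') = 6" if "rich T" "rich T'" "T \<inter> T' = {}" for T T'
    using that rich_D[of T] rich_D[of T'] by (simp add: card_Un_disjoint)
  obtain A T T' where "A \<in> X" "rich T" "rich T'" "T \<inter> T' = {}" "T \<union> T' \<subseteq> A"
    using False unfolding disjointly_rich_def by blast
  then have r6: "6 \<le> r" using key[of T T'] X_D[of A] card_mono[of A "T \<union> T'"] by auto
  let ?I = "{T. rich T} \<times> {T. rich T}"
  let ?f = "\<lambda>(T, T'). if card (T \<union> T') = 6 then {A \<in> X. T \<union> T' \<subseteq> A} else {}"
  have "card disjointly_rich \<le> card ?I * card V ^ (r - 6)"
  proof (rule card_le_of_cover)
    show "finite ?I" using fin_rich by blast
    show "disjointly_rich \<subseteq> (\<Union>i\<in>?I. ?f i)"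
    proof
      fix A assume "A \<in> disjointly_rich"
      then obtain T T' where "A \<in> X" "rich T" "rich T'" "T \<inter> T' = {}" "T \<union> T' \<subseteq> A"
        unfolding disjointly_rich_def by blast
      then show "A \<in> (\<Union>i\<in>?I. ?f i)" using key[of T T'] by (intro UN_I[of "(T, T')"]) simp_all
    qed
    fix i assume i: "i \<in> ?I"
    show "finite (?f i)" using finX by (simp add: case_prod_beta)
    obtain T T' where [simp]: "i = (T, T')" by (cases i)
    have "finite (T \<union> T')" using i rich_D by simp
    then show "card (?f i) \<le> card V ^ (r - 6)"
      using card_containing[of "T \<union> T'"] r6 by (cases "card (T \<union> T') = 6") simp_all
  qed
  also have "\<dots> = num_rich * (num_rich * card V ^ (r - 6))" by (simp add: card_cartesian_product num_rich_def)
  also have "\<dots> \<le> num_rich * ((3 * card V ^ 2) * card V ^ (r - 6))"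
    by (intro mult_le_mono num_rich_quadratic order_refl)
  also have "\<dots> = 3 * num_rich * card V ^ (2 + (r - 6))" by (simp only: power_add mult_ac)
  also have "2 + (r - 6) = r - 4" using r6 by simp
  finally show ?thesis .
qed simp

subsection \<open>Members built on a pair\<close>

definition leaves :: "'a set \<Rightarrow> 'a set" where
  "leaves P = {u. u \<notin> P \<and> rich (insert u P)}"

definition starred :: "'a set \<Rightarrow> 'a set \<Rightarrow> bool" where
  "starred P A \<longleftrightarrow> card P = 2 \<and> P \<subseteq> A \<and> A - P \<subseteq> leaves P"

lemma leaves_sub: "leaves P \<subseteq> V"
  using rich_subV by (auto simp: leaves_def)

lemma fin_leaves: "finite (leaves P)" using leaves_sub finV finite_subset by blast

text \<open>Distinct rich triples inside \<open>A\<close> meet in exactly two points. Since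
  \<open>r\<close> is at least 4, two of them, \<open>T0\<close> and \<open>T1\<close>, exist; a
  rich triple through a point \<open>v\<close> outside both meets each in all but \<open>v\<close>,
  hence consists of \<open>v\<close> and \<open>T0 \<inter> T1\<close>.\<close>

lemma starred_ex:
  assumes A: "A \<in> X" and cov: "\<And>u. u \<in> A \<Longrightarrow> \<exists>T. rich T \<and> u \<in> T \<and> T \<subseteq> A"
    and nd: "\<And>T T'. rich T \<Longrightarrow> rich T' \<Longrightarrow> T \<subseteq> A \<Longrightarrow> T' \<subseteq> A \<Longrightarrow> T \<inter> T' \<noteq> {}"
  shows "\<exists>P. starred P A"
proof -
  have cA: "card A = r" "finite A" using X_D[OF A] by auto
  have meet: "T \<inter> T' = T - {v}" "card (T \<inter> T') = 2"
    if "rich T" "rich T'" "T \<subseteq> A" "T' \<subseteq> A" "v \<in> T" "v \<notin> T'" for T T' v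
  proof -
    have f: "finite T" "card T = 3" using rich_D that by auto
    have "card (T \<inter> T') \<noteq> 0" using nd[OF that(1-4)] f by simp
    moreover have "card (T \<inter> T') \<noteq> 1" by (rule rich_rich_meet[OF that(1,2)])
    ultimately have ge: "2 \<le> card (T \<inter> T')" by linarith
    have c: "card (T - {v}) = 2" using f that by simp
    show "T \<inter> T' = T - {v}"
      by (rule card_seteq) (use f that c ge in auto)
    then show "card (T \<inter> T') = 2" using c by simp
  qed
  from cA r4 obtain u where "u \<in> A" by fastforce
  then obtain T0 where T0: "rich T0" "T0 \<subseteq> A" using cov by blast
  have "card T0 < card A" using rich_D[OF T0(1)] cA r4 by simp
  then obtain w where w: "w \<in> A" "w \<notin> T0" using T0 by (metis less_irrefl subsetI subset_antisym)
  then obtain T1 where T1: "rich T1" "w \<in> T1" "T1 \<subseteq> A" using cov by blast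
  let ?P = "T0 \<inter> T1"
  have P1: "T1 \<inter> T0 = T1 - {w}" "card (T1 \<inter> T0) = 2" using meet[OF T1(1) T0(1) T1(3) T0(2) T1(2) w(2)] by auto
  have cP: "card ?P = 2" using P1 by (simp add: Int_commute)
  have T1eq: "T1 = insert w ?P" using P1 T1 by auto
  have "rich (insert v ?P)" if v: "v \<in> A" "v \<notin> ?P" for v
  proof -
    consider "v \<in> T0" | "v \<in> T1" | "v \<notin> T0" "v \<notin> T1" by blast
    then show ?thesis
    proof cases
      case 1
      then have "T0 \<inter> T1 = T0 - {v}" using meet(1)[OF T0(1) T1(1) T0(2) T1(3)] v by blast
      then have "insert v ?P = T0" using 1 by auto
      then show ?thesis using T0 by simp
    next
      case 2
      then have "v = w" using T1eq v by auto
      then show ?thesis using T1eq T1 by metis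
    next
      case 3
      obtain T2 where T2: "rich T2" "v \<in> T2" "T2 \<subseteq> A" using cov v by blast
      have m: "T2 \<inter> T0 = T2 - {v}" "T2 \<inter> T1 = T2 - {v}" "card (T2 \<inter> T0) = 2"
        using meet[OF T2(1) T0(1) T2(3) T0(2) T2(2) 3(1)] meet[OF T2(1) T1(1) T2(3) T1(3) T2(2) 3(2)] by auto
      then have "T2 - {v} \<subseteq> ?P" by blast
      moreover have "finite ?P" using rich_D[OF T0(1)] by simp
      ultimately have "T2 - {v} = ?P" using m cP by (intro card_seteq) auto
      then show ?thesis using T2 by (metis insert_Diff)
    qed
  qed
  then have "starred ?P A" using cP T0 unfolding starred_def leaves_def by blast
  then show ?thesis by blast
qed

text \<open>A common leaf \<open>u\<close> forces a common point \<open>x\<close> of the two pairs.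
  Three leaves of \<open>P\<close> leave one outside \<open>P'\<close> and different from
  \<open>u\<close>; its triple meets \<open>insert u P'\<close> in \<open>x\<close> alone.\<close>

lemma leaves_disjoint:
  assumes P: "card P = 2" "3 \<le> card (leaves P)" and P': "card P' = 2" "P \<noteq> P'"
  shows "leaves P \<inter> leaves P' = {}"
proof (rule ccontr)
  assume "leaves P \<inter> leaves P' \<noteq> {}"
  then obtain u where u: "u \<notin> P" "rich (insert u P)" "u \<notin> P'" "rich (insert u P')"
    by (auto simp: leaves_def)
  have fP: "finite P" "finite P'" using P P' by (auto intro: card_ge_0_finite)
  have "card (insert u P \<inter> insert u P') \<noteq> 1" by (rule rich_rich_meet[OF u(2,4)])
  then have "P \<inter> P' \<noteq> {}" using u by auto
  then obtain x where x: "x \<in> P" "x \<in> P'" by blast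
  have "card (P - {x}) = 1" "card (P' - {x}) = 1" using x P P' fP by auto
  then obtain y z where "P - {x} = {y}" "P' - {x} = {z}" by (meson card_1_singletonE)
  then have yz: "P = {x, y}" "P' = {x, z}" "y \<noteq> x" "z \<noteq> x" using x by auto
  have "\<not> leaves P \<subseteq> {u, z}"
    using P(2) card_mono[of "{u, z}" "leaves P"] card_insert_le_m1[of 2 "{z}" u] by auto
  then obtain v where v: "v \<in> leaves P" "v \<noteq> u" "v \<noteq> z" by auto
  have "insert v P \<inter> insert u P' = {x}" using v u yz P'(2) by (auto simp: leaves_def)
  then show False using rich_rich_meet[of "insert v P" "insert u P'"] v u by (simp add: leaves_def)
qed

text \<open>With \<open>a\<close> the mate of a leaf \<open>u\<close>, inseparability makes
  \<open>{u, x, v}\<close> rich if \<open>a\<close> is in \<open>P\<close>, and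
  \<open>{x, u, a}\<close> rich otherwise. Either meets the triple of a further leaf in
  \<open>x\<close> alone.\<close>

lemma leaves_paired:
  assumes P: "card P = 2" "3 \<le> card (leaves P)"
  shows "leaves P \<inter> paired = {}"
proof (rule ccontr)
  assume "leaves P \<inter> paired \<noteq> {}"
  then obtain u where u: "u \<notin> P" "rich (insert u P)" "u \<in> paired" by (auto simp: leaves_def)
  define a where "a = mate u"
  have a: "a \<noteq> u" "\<And>A. A \<in> X \<Longrightarrow> a \<in> A \<longleftrightarrow> u \<in> A"
    using mate_neq mate_mem u by (auto simp: a_def)
  have big: "\<exists>v. v \<in> leaves P \<and> v \<noteq> s \<and> v \<noteq> t" for s t
  proof -
    have "\<not> leaves P \<subseteq> {s, t}"
      using P(2) card_mono[of "{s, t}" "leaves P"] card_insert_le_m1[of 2 "{t}" s] by auto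
    then show ?thesis by blast
  qed
  have fP: "finite P" using P by (auto intro: card_ge_0_finite)
  show False
  proof (cases "a \<in> P")
    case True
    then have "card (P - {a}) = 1" using P fP by simp
    then obtain x where "P - {a} = {x}" by (meson card_1_singletonE)
    then have x: "P = {x, a}" "x \<noteq> a" using True by auto
    obtain v where v: "v \<in> leaves P" "v \<noteq> u" using big by blast
    obtain w where w: "w \<in> leaves P" "w \<noteq> u" "w \<noteq> v" using big by blast
    have "rich {u, x, v}"
    proof (rule rich_mono[of "insert v P"])
      show "rich (insert v P)" using v by (simp add: leaves_def)
      show "card {u, x, v} = 3" using u v x by (auto simp: leaves_def)
      show "{u, x, v} \<subseteq> A" if "A \<in> X" "insert v P \<subseteq> A" for A
        using a(2)[OF that(1)] that(2) x by blast
    qed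
    moreover have "rich (insert w P)" using w by (simp add: leaves_def)
    moreover have "{u, x, v} \<inter> insert w P = {x}" using u v w x a by (auto simp: leaves_def)
    ultimately show False using rich_rich_meet[of "{u, x, v}" "insert w P"] by simp
  next
    case False
    obtain x where x: "x \<in> P" using P by fastforce
    have "card (P - {x}) = 1" using P fP x by simp
    then obtain y where "P - {x} = {y}" by (meson card_1_singletonE)
    then have xy: "P = {x, y}" "x \<noteq> y" using x by auto
    have "rich {x, u, a}"
    proof (rule rich_mono[of "insert u P"])
      show "rich (insert u P)" by (rule u)
      show "card {x, u, a} = 3" using u a(1) False xy by auto
      show "{x, u, a} \<subseteq> A" if "A \<in> X" "insert u P \<subseteq> A" for A
        using a(2)[OF that(1)] that(2) xy by blast
    qed
    moreover obtain v where v: "v \<in> leaves P" "v \<noteq> u" "v \<noteq> a" using big by blast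
    then have "rich (insert v P)" by (simp add: leaves_def)
    moreover have "{x, u, a} \<inter> insert v P = {x}" using u v xy a(1) False by (auto simp: leaves_def)
    ultimately show False using rich_rich_meet[of "{x, u, a}" "insert v P"] by simp
  qed
qed

definition few_leaved :: "'a set set" where
  "few_leaved = {A \<in> X. \<exists>P. starred P A \<and> card (leaves P) \<le> 2}"

text \<open>The \<open>r - 2\<close> points outside \<open>P\<close> are leaves, so at most two
  leaves force \<open>r = 4\<close> and \<open>A = P \<union> leaves P\<close>. Then
  \<open>A\<close> is determined by a rich triple with a marked point, the removal of which gives
  \<open>P\<close>.\<close>

lemma card_few_leaved: "card few_leaved \<le> 3 * num_rich * card V ^ (r - 4)"
proof (cases "few_leaved = {}")
  case False
  have key: "r = 4 \<and> A = P \<union> leaves P \<and> (\<exists>v. v \<notin> P \<and> rich (insert v P))"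
    if "A \<in> X" "starred P A" "card (leaves P) \<le> 2" for A P
  proof -
    have c: "card P = 2" "P \<subseteq> A" "A - P \<subseteq> leaves P" using that by (auto simp: starred_def)
    have f: "finite A" "card A = r" using X_D that by auto
    have "finite P" using c f finite_subset by blast
    then have d: "card (A - P) = r - 2" using c f by (simp add: card_Diff_subset)
    moreover have "card (A - P) \<le> card (leaves P)" using c fin_leaves by (intro card_mono)
    ultimately have r: "r = 4" using r4 that by linarith
    have "A - P = leaves P" by (rule card_seteq) (use fin_leaves c d r that in auto)
    moreover have "A - P \<noteq> {}" using d r by force
    ultimately show ?thesis using r c by (auto simp: leaves_def)
  qed
  have r: "r = 4" using False key unfolding few_leaved_def by blast
  have "card few_leaved \<le> card (SIGMA T : {T. rich T}. T)"
  proof (rule surj_card_le)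
    show fin: "finite (SIGMA T : {T. rich T}. T)" using fin_rich rich_D by (intro finite_SigmaI) auto
    show "few_leaved \<subseteq> (\<lambda>(T, v). (T - {v}) \<union> leaves (T - {v})) ` (SIGMA T : {T. rich T}. T)"
    proof
      fix A assume "A \<in> few_leaved"
      then obtain P where "A \<in> X" "starred P A" "card (leaves P) \<le> 2" unfolding few_leaved_def by blast
      from key[OF this] obtain v where v: "A = P \<union> leaves P" "v \<notin> P" "rich (insert v P)" by blast
      then show "A \<in> (\<lambda>(T, v). (T - {v}) \<union> leaves (T - {v})) ` (SIGMA T : {T. rich T}. T)"
        by (intro image_eqI[of _ _ "(insert v P, v)"]) auto
    qed
  qed
  also have "\<dots> = (\<Sum>T | rich T. card T)" using fin_rich rich_D by (intro card_SigmaI) auto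
  also have "\<dots> = 3 * num_rich" using rich_D by (simp add: num_rich_def)
  finally show ?thesis using r by simp
qed simp

section \<open>Members made up of inseparable pairs\<close>

definition all_paired :: "'a set set" where "all_paired = {A \<in> X. \<forall>u\<in>A. u \<in> paired \<and> bad u A}"

lemma all_paired_mate: "A \<in> all_paired \<Longrightarrow> u \<in> A \<Longrightarrow> u \<in> paired \<and> mate u \<in> A \<and> mate u \<noteq> u \<and> mate (mate u) = u"
  using mate_mem mate_neq mate_mate by (auto simp: all_paired_def)

lemma all_paired_pick:
  assumes A: "A \<in> all_paired" and S: "finite S" "card S < r"
  obtains u where "u \<in> A" "u \<notin> S"
proof -
  have "card S < card A" using A S X_D by (auto simp: all_paired_def)
  then have "\<not> A \<subseteq> S" using card_mono[of S A] S by linarith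
  then show ?thesis using that by blast
qed

text \<open>A member is a union of two mate pairs. It contains 4 * 2 ordered pairs of points from
  different mate pairs, and each of these determines it.\<close>

lemma card_all_paired_four:
  assumes r: "r = 4"
  shows "8 * card all_paired \<le> card paired ^ 2"
proof -
  let ?F = "\<lambda>A. SIGMA u : A. A - {u, mate u}"
  have fin: "finite A" "card A = 4" if "A \<in> all_paired" for A
  proof -
    have "A \<in> X" using that by (simp add: all_paired_def)
    from X_D(2,3)[OF this] r show "finite A" "card A = 4" by simp_all
  qed
  have cF: "card (?F A) = 8" if A: "A \<in> all_paired" for A
  proof -
    have "card (A - {u, mate u}) = 2" if "u \<in> A" for u
    proof -
      have "card {u, mate u} = 2" "{u, mate u} \<subseteq> A" using all_paired_mate[OF A that] that by auto
      then show ?thesis using fin[OF A] by (simp add: card_Diff_subset)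
    qed
    then show ?thesis using fin[OF A] by (subst card_SigmaI) auto
  qed
  have det: "A = {u, mate u, v, mate v}" if A: "A \<in> all_paired" and uv: "(u, v) \<in> ?F A" for A u v
  proof -
    have u: "u \<in> A" "mate u \<in> A" "mate u \<noteq> u" "mate (mate u) = u"
      and v: "v \<in> A" "mate v \<in> A" "mate v \<noteq> v" "mate (mate v) = v" "v \<noteq> u" "v \<noteq> mate u"
      using all_paired_mate[OF A, of u] all_paired_mate[OF A, of v] uv by auto
    then have "mate v \<noteq> u" "mate v \<noteq> mate u" by metis+
    then have "card {u, mate u, v, mate v} = 4" using u v by auto
    then have "{u, mate u, v, mate v} = A" using u v fin[OF A] by (intro card_seteq) auto
    then show ?thesis by simp
  qed
  have "card (Sigma all_paired ?F) \<le> card (paired \<times> paired)"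
  proof (rule card_inj_on_le[of snd])
    show "inj_on snd (Sigma all_paired ?F)"
    proof (rule inj_onI)
      fix p q assume "p \<in> Sigma all_paired ?F" "q \<in> Sigma all_paired ?F" and e: "snd p = snd q"
      then obtain A u v B where pq: "p = (A, (u, v))" "q = (B, (u, v))" "A \<in> all_paired" "B \<in> all_paired"
        "(u, v) \<in> ?F A" "(u, v) \<in> ?F B" by (cases p; cases q) auto
      then show "p = q" using det[of A u v] det[of B u v] by simp
    qed
    show "snd ` Sigma all_paired ?F \<subseteq> paired \<times> paired" using all_paired_mate by (auto simp: all_paired_def)
    show "finite (paired \<times> paired)" using fin_paired by simp
  qed
  moreover have "card (Sigma all_paired ?F) = (\<Sum>A\<in>all_paired. card (?F A))"
  proof (rule card_SigmaI)
    show "finite all_paired" using finX by (simp add: all_paired_def)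
    show "\<forall>A\<in>all_paired. finite (?F A)" using fin(1) by blast
  qed
  moreover have "\<dots> = card all_paired * 8" using cF by simp
  ultimately show ?thesis by (simp add: card_cartesian_product power2_eq_square)
qed

text \<open>Five points do not fit into two mate pairs, so there are three: three choices fix six
  points, one power of \<open>card V\<close> below the main term.\<close>

lemma card_all_paired_ge5:
  assumes r: "5 \<le> r"
  shows "card all_paired \<le> card V ^ (r - 3)"
proof (cases "all_paired = {}")
  case False
  let ?six = "\<lambda>u v w. {u, mate u, v, mate v, w, mate w}"
  have key: "\<exists>u v w. u \<in> paired \<and> v \<in> paired \<and> w \<in> paired \<and> ?six u v w \<subseteq> A \<and> card (?six u v w) = 6"
    if A: "A \<in> all_paired" for A
  proof -
    obtain u where u: "u \<in> A" using all_paired_pick[OF A, of "{}"] r by auto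
    obtain v where v: "v \<in> A" "v \<notin> {u, mate u}"
    proof (rule all_paired_pick[OF A, of "{u, mate u}"])
      show "card {u, mate u} < r" using card_length[of "[u, mate u]"] r by simp
    qed simp_all
    have "card {u, mate u, v, mate v} \<le> 4"
      using card_length[of "[u, mate u, v, mate v]"] by simp
    then obtain w where w: "w \<in> A" "w \<notin> {u, mate u, v, mate v}"
      using all_paired_pick[OF A, of "{u, mate u, v, mate v}"] r by auto
    have u': "u \<in> paired" "mate u \<in> A" "mate u \<noteq> u" "mate (mate u) = u"
      and v': "v \<in> paired" "mate v \<in> A" "mate v \<noteq> v" "mate (mate v) = v"
      and w': "w \<in> paired" "mate w \<in> A" "mate w \<noteq> w" "mate (mate w) = w"
      using all_paired_mate[OF A u] all_paired_mate[OF A v(1)] all_paired_mate[OF A w(1)] by auto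
    have "mate v \<noteq> u" "mate v \<noteq> mate u" using u' v v' by (metis insertCI)+
    moreover have "mate w \<noteq> u" "mate w \<noteq> mate u" "mate w \<noteq> v" "mate w \<noteq> mate v"
      using u' v' w w' by (metis insertCI)+
    ultimately have "card (?six u v w) = 6" using u' v v' w w' by auto
    moreover have "?six u v w \<subseteq> A" using u u'(2) v(1) v'(2) w(1) w'(2) by simp
    ultimately show ?thesis using u'(1) v'(1) w'(1) by blast
  qed
  have r6: "6 \<le> r"
  proof -
    obtain A where A: "A \<in> all_paired" using False by blast
    then have "A \<in> X" by (simp add: all_paired_def)
    from X_D(2,3)[OF this] have fA: "card A = r" "finite A" by simp_all
    obtain u v w where "?six u v w \<subseteq> A" "card (?six u v w) = 6" using key[OF A] by blast
    from card_mono[OF fA(2) this(1)] this(2) fA(1) show ?thesis by linarith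
  qed
  let ?f = "\<lambda>(u, v, w). if card (?six u v w) = 6 then {A \<in> X. ?six u v w \<subseteq> A} else {}"
  have "card all_paired \<le> card (paired \<times> paired \<times> paired) * card V ^ (r - 6)"
  proof (rule card_le_of_cover)
    show "finite (paired \<times> paired \<times> paired)" using fin_paired by blast
    show "all_paired \<subseteq> (\<Union>i\<in>paired \<times> paired \<times> paired. ?f i)"
    proof
      fix A assume A: "A \<in> all_paired"
      then obtain u v w where k: "u \<in> paired" "v \<in> paired" "w \<in> paired" "?six u v w \<subseteq> A" "card (?six u v w) = 6"
        using key by blast
      have "A \<in> ?f (u, v, w)" using k(4,5) A by (simp add: all_paired_def)
      then show "A \<in> (\<Union>i\<in>paired \<times> paired \<times> paired. ?f i)" using k(1-3) by blast
    qed
    fix i assume i: "i \<in> paired \<times> paired \<times> paired"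
    show "finite (?f i)" using finX by (simp add: case_prod_beta)
    obtain u v w where [simp]: "i = (u, v, w)" by (cases i)
    show "card (?f i) \<le> card V ^ (r - 6)"
      using card_containing[of "?six u v w"] r6 by (cases "card (?six u v w) = 6") simp_all
  qed
  also have "\<dots> = card paired ^ 3 * card V ^ (r - 6)"
    by (simp add: card_cartesian_product power3_eq_cube)
  also have "\<dots> \<le> card V ^ 3 * card V ^ (r - 6)"
    using finV paired_sub by (intro mult_le_mono1 power_mono card_mono) auto
  also have "\<dots> = card V ^ (r - 3)" using r6 by (simp flip: power_add)
  finally show ?thesis .
qed simp

text \<open>The factor 1/4 is what makes unions of inseparable pairs lose against a single pair when
  \<open>r = 4\<close>; for larger \<open>r\<close> they are of lower order.\<close>

lemma fact_card_all_paired: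
  "fact (r - 2) * real (card all_paired) \<le> fact (r - 2) * real (card V) ^ (r - 3) + real (card paired) * (real (card V) ^ (r - 3) / 4)"
proof (cases "r = 4")
  case True
  have "real (8 * card all_paired) \<le> real (card paired ^ 2)" using card_all_paired_four[OF True] by (simp only: of_nat_le_iff)
  moreover have "real (card paired) * real (card paired) \<le> real (card paired) * real (card V)"
    using finV paired_sub by (intro mult_left_mono) (auto intro: card_mono)
  ultimately have "8 * real (card all_paired) \<le> real (card paired) * real (card V)" by (simp add: power2_eq_square)
  then have "2 * real (card all_paired) \<le> 2 * real (card V) + real (card paired) * (real (card V) / 4)"
    using of_nat_0_le_iff[of "card V", where ?'a = real] by linarith
  then show ?thesis using True by (simp add: fact_numeral)
next
  case False
  then have "real (card all_paired) \<le> real (card V ^ (r - 3))" using r4 by (intro of_nat_mono card_all_paired_ge5) auto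
  then have "fact (r - 2) * real (card all_paired) \<le> fact (r - 2) * real (card V) ^ (r - 3)"
    by (intro mult_left_mono) auto
  then show ?thesis by (simp add: add_increasing2)
qed

lemma card_all_paired: "real (card all_paired) \<le> real (card V) ^ (r - 3) + real (card paired) * real (card V) ^ (r - 3)"
proof (cases "r = 4")
  case True
  have "real (8 * card all_paired) \<le> real (card paired ^ 2)" using card_all_paired_four[OF True] by (simp only: of_nat_le_iff)
  moreover have "real (card paired) * real (card paired) \<le> real (card paired) * real (card V)"
    using finV paired_sub by (intro mult_left_mono) (auto intro: card_mono)
  ultimately have "8 * real (card all_paired) \<le> real (card paired) * real (card V)" by (simp add: power2_eq_square)
  moreover have "0 \<le> real (card paired) * real (card V)" by simp
  ultimately have "real (card all_paired) \<le> real (card V) + real (card paired) * real (card V)"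
    using of_nat_0_le_iff[of "card V", where ?'a = real] by linarith
  then show ?thesis using True by simp
next
  case False
  then have "real (card all_paired) \<le> real (card V ^ (r - 3))" using r4 by (intro of_nat_mono card_all_paired_ge5) auto
  then show ?thesis by (simp add: add_increasing2)
qed

section \<open>Counting members by their centres\<close>

text \<open>Three leaves is what \<open>leaves_disjoint\<close> and \<open>leaves_paired\<close> ask
  for; pairs with fewer leaves are absorbed by \<open>few_leaved\<close>.\<close>

definition centres :: "'a set set" where
  "centres = {P. card P = 2 \<and> 3 \<le> card (leaves P)}"

lemma centres_D: "P \<in> centres \<Longrightarrow> card P = 2" "P \<in> centres \<Longrightarrow> 3 \<le> card (leaves P)"
  "P \<in> centres \<Longrightarrow> P \<subseteq> V"
proof -
  show "P \<in> centres \<Longrightarrow> card P = 2" "P \<in> centres \<Longrightarrow> 3 \<le> card (leaves P)"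
    by (auto simp: centres_def)
  assume "P \<in> centres"
  then have "leaves P \<noteq> {}" by (auto simp: centres_def)
  then show "P \<subseteq> V" using rich_subV by (force simp: leaves_def)
qed

lemma fin_centres: "finite centres"
  by (rule finite_subset[of _ "Pow V"]) (use centres_D(3) finV in auto)

lemma sum_leaves: "(\<Sum>P\<in>centres. card (leaves P)) + card paired \<le> card V"
proof -
  have "(\<Sum>P\<in>centres. card (leaves P)) = card (\<Union>P\<in>centres. leaves P)"
    using fin_centres fin_leaves leaves_disjoint centres_D(1,2)
    by (intro card_UN_disjoint[symmetric]) auto
  moreover have "card (\<Union>P\<in>centres. leaves P) + card paired = card ((\<Union>P\<in>centres. leaves P) \<union> paired)"
    using leaves_paired centres_D(1,2) fin_centres fin_leaves fin_paired
    by (intro card_Un_disjoint[symmetric]) auto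
  moreover have "\<dots> \<le> card V" using finV leaves_sub paired_sub by (intro card_mono) auto
  ultimately show ?thesis by linarith
qed

lemma card_starred: assumes "card P = 2" shows "card {A \<in> X. starred P A} \<le> card (leaves P) choose (r - 2)"
proof -
  have fP: "finite P" using assms by (auto intro: card_ge_0_finite)
  have "card {A \<in> X. starred P A} \<le> card {B. B \<subseteq> leaves P \<and> card B = r - 2}"
  proof (rule card_inj_on_le[of "\<lambda>A. A - P"])
    show "inj_on (\<lambda>A. A - P) {A \<in> X. starred P A}"
      by (rule inj_onI) (auto simp: starred_def)
    show "(\<lambda>A. A - P) ` {A \<in> X. starred P A} \<subseteq> {B. B \<subseteq> leaves P \<and> card B = r - 2}"
      using X_D fP by (auto simp: starred_def card_Diff_subset)
    show "finite {B. B \<subseteq> leaves P \<and> card B = r - 2}" using fin_leaves by simp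
  qed
  then show ?thesis using n_subsets[OF fin_leaves] by simp
qed

text \<open>Outside the exceptional classes a member that is not \<open>all_paired\<close> has a
  point that is not bad, hence contains a rich triple. Then no point of it is bad: an unpaired bad
  point would make it \<open>poorly_covered\<close>, a paired one \<open>rich_and_paired\<close>. So
  \<open>starred_ex\<close> applies.\<close>

lemma X_cover: "X \<subseteq> (poorly_covered \<union> rich_and_paired \<union> disjointly_rich \<union> few_leaved) \<union> all_paired \<union> (\<Union>P\<in>centres. {A \<in> X. starred P A})"
proof
  fix A assume A: "A \<in> X"
  show "A \<in> (poorly_covered \<union> rich_and_paired \<union> disjointly_rich \<union> few_leaved) \<union> all_paired \<union> (\<Union>P\<in>centres. {A \<in> X. starred P A})"
  proof (cases "A \<in> poorly_covered \<union> rich_and_paired \<union> disjointly_rich \<union> all_paired")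
    case False
    have badW: "u \<in> paired" if "bad u A" for u
    proof -
      have "u \<in> V" using that X_D[OF A] by (auto simp: bad_def)
      then show ?thesis using that False A by (auto simp: poorly_covered_def)
    qed
    from False A obtain v where v: "v \<in> A" "\<not> bad v A" using badW by (auto simp: all_paired_def)
    then obtain T where T: "rich T" "T \<subseteq> A" using A by (auto simp: bad_def)
    have nb: "\<not> bad u A" for u using badW[of u] T False A by (auto simp: rich_and_paired_def)
    have "\<exists>P. starred P A"
    proof (rule starred_ex[OF A])
      show "\<exists>T. rich T \<and> u \<in> T \<and> T \<subseteq> A" if "u \<in> A" for u
        using nb[of u] that A by (auto simp: bad_def)
      show "T \<inter> T' \<noteq> {}" if "rich T" "rich T'" "T \<subseteq> A" "T' \<subseteq> A" for T T'
        using that False A by (auto simp: disjointly_rich_def)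
    qed
    then obtain P where P: "starred P A" by blast
    show ?thesis
    proof (cases "card (leaves P) \<le> 2")
      case True
      then show ?thesis using P A by (auto simp: few_leaved_def)
    next
      case False
      then have "P \<in> centres" using P by (auto simp: centres_def starred_def)
      then show ?thesis using P A by blast
    qed
  qed auto
qed

text \<open>The 7 is 1 + 3 + 3 from the classes counted through \<open>num_rich\<close>; the last
  summand pays for the first term in the bounds on \<open>all_paired\<close>.\<close>

definition err :: nat where
  "err = card V * bad_bound + 7 * num_rich * card V ^ (r - 4) + card V ^ (r - 3)"

lemma card_exceptional: "card (poorly_covered \<union> rich_and_paired \<union> disjointly_rich \<union> few_leaved) + card V ^ (r - 3) \<le> err"
proof -
  have "card (poorly_covered \<union> rich_and_paired \<union> disjointly_rich \<union> few_leaved) \<le> card poorly_covered + card rich_and_paired + card disjointly_rich + card few_leaved"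
    by (meson add_le_mono1 card_Un_le order_trans)
  then show ?thesis
    using card_poorly_covered card_rich_and_paired card_disjointly_rich card_few_leaved unfolding err_def by (simp add: algebra_simps)
qed

lemma fin_except: "finite (poorly_covered \<union> rich_and_paired \<union> disjointly_rich \<union> few_leaved)" "finite all_paired" 
  using finX by (auto simp: poorly_covered_def rich_and_paired_def disjointly_rich_def few_leaved_def all_paired_def)

text \<open>Needed for two choices: \<open>S = centres\<close> counts all of \<open>X\<close>, and
  \<open>S = centres - {P}\<close> counts the members not starred at \<open>P\<close>.\<close>

lemma card_X_bound:
  assumes S: "S \<subseteq> centres"
  shows "real (card {A \<in> X. \<forall>P\<in>centres - S. \<not> starred P A}) + real (card V) ^ (r - 3)
    \<le> real err + real (card all_paired) + (\<Sum>P\<in>S. real (card (leaves P) choose (r - 2)))"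
proof -
  have fS: "finite S" using S fin_centres finite_subset by blast
  have "card {A \<in> X. \<forall>P\<in>centres - S. \<not> starred P A}
      \<le> card ((poorly_covered \<union> rich_and_paired \<union> disjointly_rich \<union> few_leaved) \<union> all_paired \<union> (\<Union>P\<in>S. {A \<in> X. starred P A}))"
    using X_cover fin_except finX fS by (intro card_mono) auto
  also have "\<dots> \<le> card (poorly_covered \<union> rich_and_paired \<union> disjointly_rich \<union> few_leaved) + card all_paired + card (\<Union>P\<in>S. {A \<in> X. starred P A})"
    by (meson add_le_mono1 card_Un_le order_trans)
  also have "card (\<Union>P\<in>S. {A \<in> X. starred P A}) \<le> (\<Sum>P\<in>S. card {A \<in> X. starred P A})"
    by (rule card_UN_le[OF fS])
  also have "\<dots> \<le> (\<Sum>P\<in>S. card (leaves P) choose (r - 2))"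
    using S centres_D by (intro sum_mono card_starred) auto
  finally have "card {A \<in> X. \<forall>P\<in>centres - S. \<not> starred P A} + card V ^ (r - 3)
     \<le> err + card all_paired + (\<Sum>P\<in>S. card (leaves P) choose (r - 2))"
    using card_exceptional by linarith
  then have "real (card {A \<in> X. \<forall>P\<in>centres - S. \<not> starred P A} + card V ^ (r - 3))
     \<le> real (err + card all_paired + (\<Sum>P\<in>S. card (leaves P) choose (r - 2)))"
    by (simp only: of_nat_le_iff)
  then show ?thesis by simp
qed

text \<open>Here \<open>q\<close> is the largest number of leaves. By \<open>sum_leaves\<close> all
  centres and paired points share a budget of \<open>card V\<close> points. A leaf contributes at a
  rate of at most \<open>q ^ (r - 3)\<close>, a paired point at a rate
  \<open>card V ^ (r - 3) / 4\<close>, both after multiplication by \<open>fact (r - 2)\<close>,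
  which keeps the main term sharp. Once the best centre is removed, a budget
  \<open>card V - q\<close> remains, and a crude rate suffices.\<close>

theorem pair_structure:
  assumes "X \<noteq> {}"
  obtains x y and q :: nat where "x \<in> V" "y \<in> V" "x \<noteq> y" "q \<le> card V"
    "fact (r - 2) * real (card X)
      \<le> fact (r - 2) * real err + real (card V) * max (real q ^ (r - 3)) (real (card V) ^ (r - 3) / 4)"
    "real (card {A \<in> X. \<not> {x, y} \<subseteq> A}) \<le> real err + real (card V - q) * real (card V) ^ (r - 3)"
proof -
  let ?k = "real (card V)" and ?l = "\<lambda>P. card (leaves P)"
  define q where "q = Max (insert 0 (?l ` centres))"
  let ?m = "max (real q ^ (r - 3)) (?k ^ (r - 3) / 4)"
  have lq: "?l P \<le> q" if "P \<in> centres" for P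
    unfolding q_def using that fin_centres by (intro Max_ge) auto
  have lk: "?l P \<le> card V" for P using leaves_sub finV by (intro card_mono) auto
  have qk: "q \<le> card V" unfolding q_def using fin_centres lk by (subst Max_le_iff) auto
  have r2: "r - 2 = Suc (r - 3)" using r4 by simp
  have sumr: "(\<Sum>P\<in>centres. real (?l P)) + real (card paired) \<le> ?k"
    using sum_leaves by (metis of_nat_add of_nat_le_iff of_nat_sum)
  have A: "fact (r - 2) * real (card X) \<le> fact (r - 2) * real err + ?k * ?m"
  proof -
    have "card X = card {A \<in> X. \<forall>P\<in>centres - centres. \<not> starred P A}" by simp
    then have "real (card X) + ?k ^ (r - 3) \<le> real err + real (card all_paired) + (\<Sum>P\<in>centres. real (?l P choose (r - 2)))"
      using card_X_bound[of centres] by simp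
    then have "fact (r - 2) * (real (card X) + ?k ^ (r - 3))
       \<le> fact (r - 2) * (real err + real (card all_paired) + (\<Sum>P\<in>centres. real (?l P choose (r - 2))))"
      by (intro mult_left_mono) auto
    moreover have "fact (r - 2) * (\<Sum>P\<in>centres. real (?l P choose (r - 2))) \<le> (\<Sum>P\<in>centres. real (?l P) * ?m)"
      unfolding sum_distrib_left
    proof (rule sum_mono)
      fix P assume P: "P \<in> centres"
      have "fact (r - 2) * (?l P choose (r - 2)) \<le> ?l P ^ (r - 2)"
        using binomial_fact_pow[of "?l P" "r - 2"] by (simp add: mult.commute)
      then have "real (fact (r - 2) * (?l P choose (r - 2))) \<le> real (?l P ^ (r - 2))"
        by (simp only: of_nat_le_iff)
      also have "\<dots> = real (?l P) * real (?l P) ^ (r - 3)" by (simp add: r2)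
      also have "\<dots> \<le> real (?l P) * ?m"
        using lq[OF P] by (intro mult_left_mono) (auto intro!: max.coboundedI1 power_mono)
      finally show "fact (r - 2) * real (?l P choose (r - 2)) \<le> real (?l P) * ?m" by simp
    qed
    moreover have "real (card paired) * (?k ^ (r - 3) / 4) \<le> real (card paired) * ?m"
      by (intro mult_left_mono) auto
    moreover have "((\<Sum>P\<in>centres. real (?l P)) + real (card paired)) * ?m \<le> ?k * ?m"
      by (intro mult_right_mono sumr) (auto simp: le_max_iff_disj)
    ultimately show ?thesis using fact_card_all_paired
      by (simp add: algebra_simps sum_distrib_left[symmetric] sum_distrib_right)
  qed
  show ?thesis
  proof (cases "centres = {}")
    case True
    obtain A where A0: "A \<in> X" using assms by blast
    then have "2 \<le> card A" using X_D r4 by force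
    then obtain S where "S \<subseteq> A" "card S = 2" by (meson obtain_subset_with_card_n)
    then obtain x y where xy: "x \<in> A" "y \<in> A" "x \<noteq> y" by (auto simp: card_2_iff)
    \<comment> \<open>Without centres the second bound holds for all of \<open>X\<close>, so any
      pair inside any member will do.\<close>
    have q0: "q = 0" by (simp add: q_def True)
    have "real (card {A \<in> X. \<not> {x, y} \<subseteq> A}) \<le> real (card X)" using finX by (intro of_nat_mono card_mono) auto
    also have "real (card X) + ?k ^ (r - 3) \<le> real err + real (card all_paired)"
      using card_X_bound[of "{}"] True by simp
    then have "real (card X) \<le> real err + real (card paired) * ?k ^ (r - 3)" using card_all_paired by linarith
    also have "\<dots> \<le> real err + real (card V - q) * ?k ^ (r - 3)"
      using q0 finV paired_sub by (intro add_left_mono mult_right_mono) (auto intro: card_mono)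
    finally show ?thesis using that[of x y q] A xy qk X_D[OF A0] by blast
  next
    case False
    have "q \<in> insert 0 (?l ` centres)" unfolding q_def using fin_centres by (intro Max_in) auto
    moreover have "q \<noteq> 0"
      using False lq centres_D(2) by fastforce
    ultimately obtain P where P: "P \<in> centres" "q = ?l P" by auto
    obtain x y where xy: "P = {x, y}" "x \<noteq> y" using centres_D(1)[OF P(1)] by (auto simp: card_2_iff)
    let ?S = "centres - {P}"
    have "centres - ?S = {P}" using P by auto
    then have "real (card {A \<in> X. \<not> starred P A}) + ?k ^ (r - 3)
       \<le> real err + real (card all_paired) + (\<Sum>P\<in>?S. real (?l P choose (r - 2)))"
      using card_X_bound[of ?S] by simp
    moreover have "card {A \<in> X. \<not> {x, y} \<subseteq> A} \<le> card {A \<in> X. \<not> starred P A}"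
      using finX xy by (intro card_mono) (auto simp: starred_def)
    moreover have "(\<Sum>P\<in>?S. real (?l P choose (r - 2))) \<le> (\<Sum>P\<in>?S. real (?l P) * ?k ^ (r - 3))"
    proof (rule sum_mono)
      fix P
      have "real (?l P choose (r - 2)) \<le> real (?l P ^ (r - 2))"
        by (intro of_nat_mono binomial_le_power)
      also have "\<dots> = real (?l P) * real (?l P) ^ (r - 3)" by (simp add: r2)
      also have "\<dots> \<le> real (?l P) * ?k ^ (r - 3)"
        using lk by (intro mult_left_mono power_mono) auto
      finally show "real (?l P choose (r - 2)) \<le> real (?l P) * ?k ^ (r - 3)" .
    qed
    moreover have "(\<Sum>P\<in>?S. real (?l P) * ?k ^ (r - 3)) + real (card paired) * ?k ^ (r - 3)
       \<le> real (card V - q) * ?k ^ (r - 3)"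
    proof -
      have "(\<Sum>P\<in>centres. real (?l P)) = real q + (\<Sum>P\<in>?S. real (?l P))"
        using sum.remove[OF fin_centres P(1), of "\<lambda>P. real (?l P)"] P(2) by simp
      then have "(\<Sum>P\<in>?S. real (?l P)) + real (card paired) \<le> real (card V - q)"
        using sumr qk by simp
      then have "((\<Sum>P\<in>?S. real (?l P)) + real (card paired)) * ?k ^ (r - 3) \<le> real (card V - q) * ?k ^ (r - 3)"
        by (rule mult_right_mono) simp
      then show ?thesis by (simp only: sum_distrib_right[symmetric] distrib_right)
    qed
    ultimately have "real (card {A \<in> X. \<not> {x, y} \<subseteq> A}) \<le> real err + real (card V - q) * ?k ^ (r - 3)"
      using card_all_paired by linarith
    then show ?thesis using that[of x y q] A xy qk centres_D(3)[OF P(1)] by blast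
  qed
qed


lemma card_X_err: "real (card X) \<le> real err + real (card V) ^ (r - 2)"
proof (cases "X = {}")
  case False
  let ?k = "real (card V)"
  obtain x y q where q: "q \<le> card V" and b: "fact (r - 2) * real (card X)
      \<le> fact (r - 2) * real err + ?k * max (real q ^ (r - 3)) (?k ^ (r - 3) / 4)"
    by (rule pair_structure[OF False])
  have r2: "r - 2 = Suc (r - 3)" using r4 by simp
  have m: "max (real q ^ (r - 3)) (?k ^ (r - 3) / 4) \<le> ?k ^ (r - 3)"
    using q by (auto intro!: power_mono)
  have "?k * max (real q ^ (r - 3)) (?k ^ (r - 3) / 4) \<le> ?k * ?k ^ (r - 3)"
    by (intro mult_left_mono m) auto
  also have "\<dots> = 1 * ?k ^ (r - 2)" by (simp add: r2)
  also have "\<dots> \<le> fact (r - 2) * ?k ^ (r - 2)"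
    by (intro mult_right_mono) (auto simp: fact_ge_1)
  finally have "fact (r - 2) * real (card X) \<le> fact (r - 2) * (real err + ?k ^ (r - 2))"
    using b by (simp add: distrib_left)
  then show ?thesis by simp
qed simp

end

text \<open>Uses the least admissible \<open>D\<close>. Losing a constant is harmless here, so rich
  triples are counted by \<open>num_rich_quadratic\<close>. The factor adds the coefficients of the
  two terms; 23 is 21 from \<open>num_rich\<close> and one each from \<open>err\<close> and from the
  main term.\<close>

lemma card_sparse_family_le:
  fixes V :: "'a set"
  assumes "finite V" "4 \<le> r" "X \<subseteq> {A. A \<subseteq> V \<and> card A = r}"
    "\<And>A. A \<in> X \<Longrightarrow> card {B \<in> X. card (A \<inter> B) = 1} \<le> \<Delta>"
  shows "card X \<le> (r + 2 * r ^ 2 + r ^ 3 + 23) * (card V ^ (r - 2) + card V * \<Delta>)"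
proof (cases "X = {}")
  case False
  let ?k = "card V"
  interpret sparse_family V r X \<Delta> "\<Delta> + r * ?k ^ (r - 4) + 1"
    using assms by unfold_locales auto
  have "0 < ?k"
  proof -
    obtain A where "A \<in> X" using False by blast
    then have "r \<le> ?k" using X_D[of A] card_mono[OF finV, of A] by auto
    then show ?thesis using r4 by linarith
  qed
  then have k1: "1 \<le> ?k" by simp
  have r2: "r - 2 = Suc (r - 3)" "r - 3 = Suc (r - 4)" "r - 2 = r - 4 + 2" using r4 by auto
  have p3: "?k ^ (r - 3) \<le> ?k ^ (r - 2)" using k1 by (intro power_increasing) auto
  have p1: "?k \<le> ?k ^ (r - 2)" using k1 r4 power_increasing[of 1 "r - 2" ?k] by auto
  have "real (card X) \<le> real (err + ?k ^ (r - 2))" using card_X_err by simp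
  then have "card X \<le> err + ?k ^ (r - 2)" by (simp only: of_nat_le_iff)
  moreover have "?k * bad_bound = (r + r ^ 2) * (?k * \<Delta>) + r ^ 3 * ?k ^ (r - 3) + r ^ 2 * ?k"
    unfolding bad_bound_def r2(2) by (simp add: algebra_simps power2_eq_square power3_eq_cube)
  moreover have "7 * num_rich * ?k ^ (r - 4) \<le> 7 * (3 * ?k ^ 2) * ?k ^ (r - 4)"
    by (intro mult_le_mono num_rich_quadratic order_refl)
  moreover have "7 * (3 * ?k ^ 2) * ?k ^ (r - 4) = 21 * ?k ^ (r - 2)"
    unfolding r2(3) power_add by simp
  moreover have "r ^ 3 * ?k ^ (r - 3) \<le> r ^ 3 * ?k ^ (r - 2)" "r ^ 2 * ?k \<le> r ^ 2 * ?k ^ (r - 2)"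
    by (rule mult_le_mono2[OF p3], rule mult_le_mono2[OF p1])
  ultimately have "card X \<le> (r + r ^ 2) * (?k * \<Delta>) + (r ^ 3 + r ^ 2 + 23) * ?k ^ (r - 2)"
    using p3 unfolding err_def distrib_right by linarith
  also have "\<dots> \<le> (r + 2 * r ^ 2 + r ^ 3 + 23) * (?k * \<Delta>) + (r + 2 * r ^ 2 + r ^ 3 + 23) * ?k ^ (r - 2)"
    by (rule add_mono[OF mult_le_mono1 mult_le_mono1]) auto
  finally show ?thesis by (simp add: distrib_left)
qed simp

section \<open>Binomial estimates and supersets avoiding a set\<close>

lemma fact_binomial_ge: "(m - k) ^ k \<le> fact k * (m choose k)"
proof (induction k)
  case (Suc k)
  have "(m - Suc k) ^ Suc k \<le> (m - k) ^ k * (m - k)"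
    by (simp add: mult.commute) (intro mult_le_mono power_mono, auto)
  also have "\<dots> \<le> fact k * (m choose k) * (m - k)" using Suc by (rule mult_le_mono1)
  also have "\<dots> = fact (Suc k) * (m choose Suc k)"
  proof -
    have "Suc k * (m choose Suc k) = (m - k) * (m choose k)"
      using binomial_absorb_comp[of m k] binomial_absorption[of k m] by simp
    then have "fact k * (Suc k * (m choose Suc k)) = fact k * ((m - k) * (m choose k))" by (rule arg_cong)
    then show ?thesis by (simp only: fact_Suc of_nat_id mult_ac)
  qed
  finally show ?case .
qed simp

text \<open>By \<open>fact_binomial_ge\<close> the right side is at least \<open>(n - t) ^ j\<close>
  with \<open>t = s + j\<close>, and Bernoulli's inequality shows that this loses only a factor
  \<open>1 - j t / n\<close>.\<close>

lemma binomial_shift_lower: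
  assumes a: "0 < a"
  shows "\<exists>n0. \<forall>n\<ge>n0. (1 - a) * real n ^ j \<le> fact j * real ((n - s) choose j)"
proof (intro exI allI impI)
  fix n :: nat
  define t where "t = s + j"
  assume n: "nat \<lceil>real j * real t / a\<rceil> + t + 1 \<le> n"
  then have n0: "0 < real n" "t \<le> n" by auto
  have "real j * real t / a \<le> real n" using n by linarith
  then have "real j * real t \<le> a * real n" using a by (simp add: field_simps)
  then have 1: "1 - a \<le> 1 + real j * (- (real t / real n))" using n0 by (simp add: field_simps)
  also have "\<dots> \<le> (1 + (- (real t / real n))) ^ j"
    using n0 by (intro Bernoulli_inequality) (simp add: field_simps)
  also have "\<dots> = real (n - t) ^ j / real n ^ j"
    using n0 by (simp add: of_nat_diff power_divide[symmetric] diff_divide_distrib)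
  finally have "(1 - a) * real n ^ j \<le> real (n - t) ^ j"
    using n0 by (simp add: field_simps)
  also have "\<dots> = real ((n - s - j) ^ j)" by (simp add: t_def)
  also have "\<dots> \<le> real (fact j * ((n - s) choose j))" by (intro of_nat_mono fact_binomial_ge)
  finally show "(1 - a) * real n ^ j \<le> fact j * real ((n - s) choose j)" by simp
qed

lemma card_supersets_avoiding:
  assumes "finite V" "K \<subseteq> V" "K \<inter> Z = {}" "Z \<subseteq> V" "card K \<le> r"
  shows "card {B. B \<subseteq> V \<and> card B = r \<and> K \<subseteq> B \<and> B \<inter> Z = {}}
    = (card V - card Z - card K) choose (r - card K)"
proof -
  have "{B. B \<subseteq> V \<and> card B = r \<and> K \<subseteq> B \<and> B \<inter> Z = {}} = {B. B \<subseteq> V - Z \<and> card B = r \<and> K \<subseteq> B}"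
    by auto
  also have "card \<dots> = (card (V - Z) - card K) choose (r - card K)"
    using assms by (intro card_supersets) auto
  finally show ?thesis using assms finite_subset[of Z V] by (simp add: card_Diff_subset)
qed

section \<open>Stability and the neighbourhood of a star\<close>

text \<open>Ordered pairs, so that the cardinality is a sum of degrees; an edge inside
  \<open>X \<inter> Y\<close> is counted twice.\<close>

definition cross_pairs :: "'a set set \<Rightarrow> 'a set set \<Rightarrow> ('a set \<times> 'a set) set" where
  "cross_pairs X Y = (SIGMA A : X. {B \<in> Y. card (A \<inter> B) = 1})"

lemma card_cross_pairs:
  assumes "finite X" "finite Y"
  shows "card (cross_pairs X Y) = (\<Sum>A\<in>X. card {B \<in> Y. card (A \<inter> B) = 1})"
  unfolding cross_pairs_def using assms by (intro card_SigmaI) auto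

text \<open>Markov's inequality for degrees.\<close>

lemma card_high_degree:
  fixes d t :: real
  assumes "finite X" "finite Y" and c: "real (card (cross_pairs X Y)) \<le> t" and d: "0 \<le> d"
  shows "d * real (card {A \<in> X. d < real (card {B \<in> Y. card (A \<inter> B) = 1})}) \<le> t"
proof -
  let ?H = "{A \<in> X. d < real (card {B \<in> Y. card (A \<inter> B) = 1})}"
  have "d * real (card ?H) = (\<Sum>A\<in>?H. d)" by simp
  also have "\<dots> \<le> (\<Sum>A\<in>?H. real (card {B \<in> Y. card (A \<inter> B) = 1}))" by (intro sum_mono) auto
  also have "\<dots> \<le> (\<Sum>A\<in>X. real (card {B \<in> Y. card (A \<inter> B) = 1}))"
    using assms by (intro sum_mono2) auto
  also have "\<dots> = real (card (cross_pairs X Y))" using assms by (simp add: card_cross_pairs)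
  finally show ?thesis using c by simp
qed

definition star :: "nat \<Rightarrow> nat \<Rightarrow> nat \<Rightarrow> nat \<Rightarrow> nat set set" where
  "star n r x y = {A \<in> kset_vertices n r. {x, y} \<subseteq> A}"

lemma finite_kset_vertices: "finite (kset_vertices n r)"
  unfolding kset_vertices_def by (rule finite_subset[of _ "Pow {1..n}"]) auto

lemma finite_star: "finite (star n r x y)"
  unfolding star_def using finite_kset_vertices by simp

lemma card_star:
  assumes "x \<in> {1..n}" "y \<in> {1..n}" "x \<noteq> y" "2 \<le> r"
  shows "card (star n r x y) = (n - 2) choose (r - 2)"
proof -
  have "star n r x y = {A. A \<subseteq> {1..n} \<and> card A = r \<and> {x, y} \<subseteq> A}"
    by (auto simp: star_def kset_vertices_def)
  moreover have "card {x, y} = 2" "{x, y} \<subseteq> {1..n}" "card {1..n} = n" using assms by auto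
  ultimately show ?thesis using card_supersets[of "{1..n}" "{x, y}" r] assms(4) by (simp only: finite_atLeastAtMost)
qed

lemma kset_D:
  assumes "A \<in> kset_vertices n r"
  shows "A \<subseteq> {1..n}" "card A = r" "finite A"
  using assms finite_subset by (auto simp: kset_vertices_def)

text \<open>The value of \<open>\<delta>\<close> makes the degree term
  \<open>4 * C * \<delta> * p\<close> half of \<open>c0 * p / (4 * r)\<close>, and
  \<open>\<epsilon>\<close> is such that the final lower bound on the number of sets outside the
  star is twice the assumed upper bound.\<close>

lemma near_star_contradiction:
  fixes n r :: nat and F :: "nat set set"
  defines "p \<equiv> real n ^ (r - 3)"
    and "S \<equiv> \<lambda>x y. star n r x y"
  assumes r: "4 \<le> r" and F: "F \<subseteq> kset_vertices n r"
    and xy: "x \<in> {1..n}" "y \<in> {1..n}" "x \<noteq> y"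
    and c0: "0 < c0" "c0 \<le> 1"
    and C: "C = real (r + 2 * r ^ 2 + r ^ 3 + 23)"
    and \<delta>: "\<delta> = c0 / (32 * real r * C)"
    and \<epsilon>: "\<epsilon> = c0 ^ 2 / (32 * real r ^ 2 * C)"
    and n1: "c0 * (real n * p) \<le> real ((n - (r + 1)) choose (r - 2))"
    and n2: "c0 * p \<le> real ((n - (r + 2)) choose (r - 3))"
    and ne: "F - S x y \<noteq> {}"
    and M: "card (S x y - F) \<le> card (F - S x y)"
    and small: "real (card (F - S x y)) \<le> \<epsilon> * (real n * p)"
    and e1: "real (card (cross_pairs (F - S x y) (F - S x y))) \<le> \<delta> * p * real (card (F - S x y))"
    and e2: "real (card (cross_pairs (F - S x y) (S x y \<inter> F))) \<le> \<delta> * p * real (card (F - S x y))"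
  shows False
proof -
  define A0 where "A0 = F - S x y"
  define M where "M = S x y - F"
  define SF where "SF = S x y \<inter> F"
  define m where "m = real (card A0)"
  have finF: "finite F" using F finite_kset_vertices finite_subset by blast
  have fin: "finite A0" "finite M" "finite SF"
    using finF finite_star by (auto simp: A0_def M_def SF_def S_def)
  have m0: "0 < m" using ne fin by (simp add: m_def A0_def card_gt_0_iff)
  have C1: "1 \<le> C" using C by simp
  have r0: "4 \<le> real r" using r by simp
  have n0: "1 \<le> real n" using xy by auto
  have p0: "0 < p" using n0 by (simp add: p_def)
  have pn: "p \<le> real n * p" using n0 p0 by simp
  have \<delta>0: "0 < \<delta>" using c0 C1 r0 by (simp add: \<delta>)
  have rC: "4 \<le> real r * C" using r0 C1 mult_mono[of 4 "real r" 1 C] by simp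
  have "4 * \<delta> = c0 / (8 * (real r * C))" by (simp add: \<delta>)
  also have "\<dots> \<le> c0 / 4" using c0 rC r0 C1 by (intro divide_left_mono mult_pos_pos) linarith+
  finally have \<delta>4: "4 * \<delta> \<le> c0 / 4" .
  have \<epsilon>eq: "\<epsilon> = c0 * (c0 / (32 * real r * (real r * C)))" by (simp add: \<epsilon> power2_eq_square)
  have "c0 / (32 * real r * (real r * C)) \<le> 1 / 4"
  proof -
    have "128 * 4 \<le> 32 * real r * (real r * C)" using r0 rC by (intro mult_mono) auto
    then show ?thesis using c0 by (simp add: divide_le_eq)
  qed
  then have "c0 * (c0 / (32 * real r * (real r * C))) \<le> c0 * (1 / 4)" using c0 by (intro mult_left_mono) auto
  then have \<epsilon>4: "\<epsilon> \<le> c0 / 4" unfolding \<epsilon>eq by linarith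
  let ?d1 = "\<lambda>A. real (card {B \<in> SF. card (A \<inter> B) = 1})"
  let ?d2 = "\<lambda>A. real (card {B \<in> A0. card (A \<inter> B) = 1})"
  \<comment> \<open>The thresholds are four times the averages, so each of the two conditions
    discards at most a quarter of \<open>A0\<close>.\<close>
  define A' where "A' = {A \<in> A0. ?d1 A \<le> 4 * \<delta> * p \<and> ?d2 A \<le> 4 * \<delta> * p}"
  have A'half: "m / 2 \<le> real (card A')"
  proof -
    let ?H1 = "{A \<in> A0. 4 * \<delta> * p < ?d1 A}" and ?H2 = "{A \<in> A0. 4 * \<delta> * p < ?d2 A}"
    have d0: "0 < \<delta> * p" using \<delta>0 p0 by simp
    have "4 * \<delta> * p * real (card ?H1) \<le> \<delta> * p * m"
      by (rule card_high_degree[OF fin(1,3)]) (use e2 \<delta>0 p0 in \<open>auto simp: A0_def SF_def m_def\<close>)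
    then have "(\<delta> * p) * (4 * real (card ?H1)) \<le> (\<delta> * p) * m" by (simp add: mult_ac)
    then have 1: "4 * real (card ?H1) \<le> m" using d0 by (rule mult_left_le_imp_le)
    have "4 * \<delta> * p * real (card ?H2) \<le> \<delta> * p * m"
      by (rule card_high_degree[OF fin(1,1)]) (use e1 \<delta>0 p0 in \<open>auto simp: A0_def m_def\<close>)
    then have "(\<delta> * p) * (4 * real (card ?H2)) \<le> (\<delta> * p) * m" by (simp add: mult_ac)
    then have 2: "4 * real (card ?H2) \<le> m" using d0 by (rule mult_left_le_imp_le)
    have "card A0 \<le> card (A' \<union> ?H1 \<union> ?H2)" using fin by (intro card_mono) (auto simp: A'_def)
    also have "\<dots> \<le> card A' + card ?H1 + card ?H2" by (meson add_le_mono1 card_Un_le order_trans)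
    finally have "real (card A0) \<le> real (card A') + real (card ?H1) + real (card ?H2)" by linarith
    then show ?thesis using 1 2 by (simp add: m_def)
  qed
  have A'V: "A \<subseteq> {1..n}" "card A = r" "finite A" "\<not> {x, y} \<subseteq> A" if "A \<in> A'" for A
  proof -
    have "A \<in> kset_vertices n r" "A \<notin> S x y" using that F by (auto simp: A'_def A0_def)
    then show "A \<subseteq> {1..n}" "card A = r" "finite A" "\<not> {x, y} \<subseteq> A"
      using kset_D[of A n r] by (auto simp: S_def star_def)
  qed
  have Msmall: "real (card M) \<le> \<epsilon> * (real n * p)" "real (card M) \<le> m"
    using M small by (auto simp: M_def m_def A0_def)
  \<comment> \<open>If \<open>A\<close> contained only \<open>z\<close> of the two points, the order
    of \<open>n * p\<close> star members avoiding \<open>A - {z}\<close> would all be neighbours of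
    \<open>A\<close>, too many for \<open>M\<close> and the few neighbours in
    \<open>SF\<close>.\<close>
  have disj: "A \<inter> {x, y} = {}" if A: "A \<in> A'" for A
  proof (rule ccontr)
    assume "A \<inter> {x, y} \<noteq> {}"
    then obtain z w where zw: "{x, y} = {z, w}" "z \<in> A" "w \<notin> A" using A'V(4)[OF A] by blast
    then have "z \<noteq> w" by blast
    then have zw': "z \<noteq> w" "{z, w} \<subseteq> {1..n}" "card {z, w} = 2" using xy zw(1) by auto
    let ?N = "{B. B \<subseteq> {1..n} \<and> card B = r \<and> {z, w} \<subseteq> B \<and> B \<inter> (A - {z}) = {}}"
    have "card ?N = (card {1..n} - card (A - {z}) - card {z, w}) choose (r - card {z, w})"
      by (rule card_supersets_avoiding) (use zw zw' A'V[OF A] r in auto)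
    also have "\<dots> = (n - (r + 1)) choose (r - 2)"
    proof -
      have c: "card (A - {z}) = r - 1" "card {1..n} = n" using A'V[OF A] zw by simp_all
      have "n - (r - 1) - 2 = n - (r + 1)" using r by simp
      then show ?thesis by (simp only: c zw'(3))
    qed
    finally have "c0 * (real n * p) \<le> real (card ?N)" using n1 by simp
    also have "card ?N \<le> card ({B \<in> SF. card (A \<inter> B) = 1} \<union> M)"
    proof (rule card_mono)
      show "?N \<subseteq> {B \<in> SF. card (A \<inter> B) = 1} \<union> M"
      proof
        fix B assume B: "B \<in> ?N"
        then have "A \<inter> B = {z}" using zw by auto
        moreover have "B \<in> S x y" using B zw(1) by (auto simp: S_def star_def kset_vertices_def)
        ultimately show "B \<in> {B \<in> SF. card (A \<inter> B) = 1} \<union> M" by (auto simp: SF_def M_def)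
      qed
    qed (use fin in auto)
    also have "\<dots> \<le> card {B \<in> SF. card (A \<inter> B) = 1} + card M" by (rule card_Un_le)
    finally have "c0 * (real n * p) \<le> ?d1 A + real (card M)" by simp
    also have "?d1 A \<le> 4 * \<delta> * p" using A by (simp add: A'_def)
    also have "4 * \<delta> * p \<le> c0 / 4 * (real n * p)" using \<delta>4 pn p0 c0 by (intro mult_mono) auto
    also have "real (card M) \<le> c0 / 4 * (real n * p)"
    proof -
      have "\<epsilon> * (real n * p) \<le> c0 / 4 * (real n * p)"
        by (rule mult_right_mono[OF \<epsilon>4]) (use n0 p0 in simp)
      then show ?thesis using Msmall(1) by linarith
    qed
    finally have "c0 * (real n * p) \<le> c0 / 4 * (real n * p) + c0 / 4 * (real n * p)" by simp
    moreover have "0 < c0 * (real n * p)" using n0 p0 c0 by simp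
    ultimately show False by linarith
  qed
  define U where "U = \<Union>A'"
  have U: "finite U" "U \<subseteq> {1..n}" using A'V finite_subset[of U "{1..n}"] by (auto simp: U_def)
  define k where "k = card U"
  have kn: "k \<le> n" using card_mono[OF _ U(2)] by (simp add: k_def)
  \<comment> \<open>The star members through \<open>u\<close> that avoid the rest of
    \<open>A\<close> are neighbours of \<open>A\<close>. Few of them lie in \<open>F\<close>, so
    most are missing from it.\<close>
  have degM: "c0 / 2 * p \<le> real (card {B \<in> M. u \<in> B})" if uU: "u \<in> U" for u
  proof -
    obtain A where A: "A \<in> A'" "u \<in> A" using uU unfolding U_def by blast
    have "u \<noteq> x" "u \<noteq> y" using disj[OF A(1)] A by blast+
    then have u: "u \<notin> {x, y}" "{x, y, u} \<subseteq> {1..n}" "card {x, y, u} = 3"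
      using A xy A'V(1)[OF A(1)] by auto
    let ?N = "{B. B \<subseteq> {1..n} \<and> card B = r \<and> {x, y, u} \<subseteq> B \<and> B \<inter> (A - {u}) = {}}"
    have "card ?N = (card {1..n} - card (A - {u}) - card {x, y, u}) choose (r - card {x, y, u})"
      by (rule card_supersets_avoiding) (use u A'V[OF A(1)] disj[OF A(1)] r in auto)
    also have "\<dots> = (n - (r + 2)) choose (r - 3)"
    proof -
      have c: "card (A - {u}) = r - 1" "card {1..n} = n" using A'V[OF A(1)] A by simp_all
      have "n - (r - 1) - 3 = n - (r + 2)" using r by simp
      then show ?thesis by (simp only: c u(3))
    qed
    finally have "c0 * p \<le> real (card ?N)" using n2 by simp
    also have "card ?N \<le> card ({B \<in> SF. card (A \<inter> B) = 1} \<union> {B \<in> M. u \<in> B})"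
    proof (rule card_mono)
      show "?N \<subseteq> {B \<in> SF. card (A \<inter> B) = 1} \<union> {B \<in> M. u \<in> B}"
      proof
        fix B assume B: "B \<in> ?N"
        then have "A \<inter> B = {u}" using A by auto
        moreover have "B \<in> S x y" using B by (auto simp: S_def star_def kset_vertices_def)
        ultimately show "B \<in> {B \<in> SF. card (A \<inter> B) = 1} \<union> {B \<in> M. u \<in> B}"
          by (auto simp: SF_def M_def)
      qed
    qed (use fin in auto)
    also have "\<dots> \<le> card {B \<in> SF. card (A \<inter> B) = 1} + card {B \<in> M. u \<in> B}" by (rule card_Un_le)
    finally have "c0 * p \<le> ?d1 A + real (card {B \<in> M. u \<in> B})" by simp
    moreover have "?d1 A \<le> 4 * \<delta> * p" using A by (simp add: A'_def)
    moreover have "4 * \<delta> * p \<le> c0 / 4 * p" using \<delta>4 p0 by (intro mult_right_mono) auto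
    moreover have "0 < c0 * p" using c0 p0 by simp
    ultimately show ?thesis by simp
  qed
  \<comment> \<open>Incidences between \<open>U\<close> and \<open>M\<close> counted twice; the size
    comparison of \<open>M\<close> with \<open>A0\<close> enters here.\<close>
  have kM: "real k * (c0 / 2 * p) \<le> real r * m"
  proof -
    have "real k * (c0 / 2 * p) \<le> (\<Sum>u\<in>U. real (card {B \<in> M. u \<in> B}))"
      unfolding k_def using degM by (intro sum_bounded_below) auto
    also have "\<dots> = real (\<Sum>u\<in>U. \<Sum>B | B \<in> M \<and> u \<in> B. 1)" by simp
    also have "(\<Sum>u\<in>U. \<Sum>B | B \<in> M \<and> u \<in> B. 1) = (\<Sum>B\<in>M. \<Sum>u | u \<in> U \<and> u \<in> B. (1::nat))"
      by (rule sum.swap_restrict) (use U fin in auto)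
    also have "\<dots> = (\<Sum>B\<in>M. card {u \<in> U. u \<in> B})" by simp
    also have "\<dots> \<le> (\<Sum>B\<in>M. r)"
    proof (rule sum_mono)
      fix B assume "B \<in> M"
      then have "B \<in> kset_vertices n r" by (simp add: M_def S_def star_def)
      from kset_D(2,3)[OF this] show "card {u \<in> U. u \<in> B} \<le> r" by (metis (no_types, lifting) card_mono mem_Collect_eq subsetI)
    qed
    also have "\<dots> = card M * r" by simp
    finally have "real k * (c0 / 2 * p) \<le> real (card M) * real r" by simp
    also have "\<dots> \<le> m * real r" using Msmall(2) by (intro mult_right_mono) auto
    finally show ?thesis by (simp add: mult.commute)
  qed
  define \<Delta> where "\<Delta> = nat \<lfloor>4 * \<delta> * p\<rfloor>"
  have D: "real \<Delta> \<le> 4 * \<delta> * p" using \<delta>0 p0 by (simp add: \<Delta>_def)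
  have "card A' \<le> (r + 2 * r ^ 2 + r ^ 3 + 23) * (card U ^ (r - 2) + card U * \<Delta>)"
  proof (rule card_sparse_family_le[OF U(1) r])
    show "A' \<subseteq> {A. A \<subseteq> U \<and> card A = r}" using A'V by (auto simp: U_def)
    fix A assume A: "A \<in> A'"
    have "card {B \<in> A'. card (A \<inter> B) = 1} \<le> card {B \<in> A0. card (A \<inter> B) = 1}"
      using fin by (intro card_mono) (auto simp: A'_def)
    also have "\<dots> \<le> \<Delta>" unfolding \<Delta>_def using A by (intro le_nat_floor) (auto simp: A'_def)
    finally show "card {B \<in> A'. card (A \<inter> B) = 1} \<le> \<Delta>" .
  qed
  then have "real (card A') \<le> real ((r + 2 * r ^ 2 + r ^ 3 + 23) * (k ^ (r - 2) + k * \<Delta>))"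
    by (simp only: k_def of_nat_le_iff)
  also have "\<dots> = C * (real k ^ (r - 2) + real k * real \<Delta>)" by (simp add: C)
  also have "\<dots> \<le> C * (real k ^ (r - 2) + real k * (4 * \<delta> * p))"
    using D C1 by (intro mult_left_mono add_left_mono) auto
  finally have cA: "m / 2 \<le> C * (real k ^ (r - 2) + real k * (4 * \<delta> * p))" using A'half by simp
  have k0: "0 < real k"
  proof -
    have "A' \<noteq> {}" using A'half m0 by auto
    then obtain A where "A \<in> A'" by blast
    then have "A \<subseteq> U" "card A = r" using A'V by (auto simp: U_def)
    then show ?thesis using card_mono[OF U(1), of A] r by (simp add: k_def)
  qed
  have r2: "r - 2 = Suc (r - 3)" "r - 3 = Suc (r - 4)" using r by auto
  have "real k * (c0 * p / (4 * real r)) \<le> m / 2"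
    using kM r0 by (simp add: field_simps)
  also have "\<dots> \<le> real k * (C * real k ^ (r - 3) + 4 * C * \<delta> * p)"
    using cA by (simp add: r2(1) algebra_simps)
  finally have "c0 * p / (4 * real r) \<le> C * real k ^ (r - 3) + 4 * C * \<delta> * p"
    using k0 by (rule mult_left_le_imp_le)
  moreover have "c0 * p / (4 * real r) = 2 * (c0 * p / (8 * real r))" by simp
  moreover have "4 * C * \<delta> * p = c0 * p / (8 * real r)" using C1 by (simp add: \<delta>)
  ultimately have "c0 * p / (8 * real r) \<le> C * real k ^ (r - 3)" by linarith
  then have "real n * (c0 * p / (8 * real r)) \<le> real n * (C * real k ^ (r - 3))"
    by (intro mult_left_mono) auto
  also have "\<dots> = C * real k * (real n * real k ^ (r - 4))" by (simp add: r2(2))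
  \<comment> \<open>One factor \<open>k\<close> is kept and the others are raised to
    \<open>n\<close>, which turns a bound on \<open>k ^ (r - 3)\<close> into a linear bound on
    \<open>k\<close>.\<close>
  also have "\<dots> \<le> C * real k * (real n * real n ^ (r - 4))"
    using kn C1 by (intro mult_left_mono power_mono) auto
  also have "\<dots> = C * real k * p" by (simp add: p_def r2(2))
  finally have "(real n * c0 / (8 * real r)) * p \<le> (C * real k) * p" by simp
  then have "real n * c0 / (8 * real r) \<le> C * real k" using p0 by (rule mult_right_le_imp_le)
  then have kbig: "real n * c0 / (8 * real r * C) \<le> real k" using C1 r0 by (simp add: field_simps)
  have "2 * (\<epsilon> * (real n * p)) * real r = (real n * c0 / (8 * real r * C)) * (c0 / 2 * p)"
    using r0 C1 by (simp add: \<epsilon> power2_eq_square mult_ac)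
  also have "\<dots> \<le> real k * (c0 / 2 * p)" using kbig c0 p0 by (intro mult_right_mono) auto
  also have "\<dots> \<le> real r * m" by (rule kM)
  finally have "2 * (\<epsilon> * (real n * p)) \<le> m" using r0 by simp
  then show False using small m0 by (simp add: m_def A0_def)
qed

text \<open>All losses are multiples of \<open>a\<close>. Discarding members of degree above
  \<open>a * p\<close> costs a fraction \<open>a\<close> of \<open>F\<close>, and \<open>err\<close>
  is at most \<open>6 * r ^ 2 * a * n * p\<close>. So the maximum in \<open>pair_structure\<close>
  is at least \<open>(1 - \<eta>) * p\<close>; as \<open>\<eta>\<close> is at most 1/2 it is not
  \<open>p / 4\<close>, and hence \<open>q\<close> is at least
  \<open>(1 - \<eta>) * n\<close>.\<close>

lemma star_stability_aux:
  fixes n r :: nat and F :: "nat set set" and a :: real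
  defines "p \<equiv> real n ^ (r - 3)"
  assumes r: "4 \<le> r" and F: "F \<subseteq> kset_vertices n r" and F0: "F \<noteq> {}"
    and a: "0 < a" and small: "(2 + 6 * fact (r - 2) * real r ^ 2) * a \<le> 1 / 2"
    and lower: "(1 - a) * (real n * p) \<le> fact (r - 2) * real (card F)"
    and upper: "real (card F) \<le> 2 * (real n * p)"
    and cross: "real (card (cross_pairs F F)) \<le> a ^ 2 * p * real (card F)"
    and n1: "real r * real n ^ (r - 4) < a * p" and n2: "1 \<le> a * p"
    and n3: "14 * real r ^ 3 / a + 1 \<le> real r ^ 2 * a * real n"
  shows "\<exists>x\<in>{1..n}. \<exists>y\<in>{1..n}. x \<noteq> y \<and>
    real (card (F - star n r x y)) \<le> (4 + 12 * fact (r - 2) * real r ^ 2) * a * (real n * p)"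
proof -
  let ?f = "fact (r - 2) :: real"
  define \<Delta> where "\<Delta> = nat \<lfloor>a * p\<rfloor>"
  \<comment> \<open>One \<open>a * p\<close> covers \<open>\<Delta>\<close>, a second covers
    \<open>r * n ^ (r - 4)\<close>, the third leaves a margin; rounding up costs at most one
    more.\<close>
  define D where "D = nat \<lceil>3 * a * p\<rceil>"
  define X where "X = {A \<in> F. real (card {B \<in> F. card (A \<inter> B) = 1}) \<le> a * p}"
  have finF: "finite F" using F finite_kset_vertices finite_subset by blast
  have r0: "4 \<le> real r" using r by simp
  have f1: "1 \<le> ?f" by (rule fact_ge_1)
  have ap: "0 < a * p" using n2 by linarith
  have p0: "0 < p" using ap a by (simp add: zero_less_mult_iff)
  have "(2 + 6 * ?f * real r ^ 2) * a \<ge> 2 * a" using a f1 by (intro mult_right_mono) auto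
  then have a4: "a \<le> 1 / 4" using small by linarith
  have r2: "r - 2 = Suc (r - 3)" "r - 3 = Suc (r - 4)" using r by auto
  have lost: "real (card (F - X)) \<le> a * real (card F)"
  proof -
    have "a * p * real (card {A \<in> F. a * p < real (card {B \<in> F. card (A \<inter> B) = 1})}) \<le> a ^ 2 * p * real (card F)"
      by (rule card_high_degree[OF finF finF cross]) (use ap in simp)
    moreover have "{A \<in> F. a * p < real (card {B \<in> F. card (A \<inter> B) = 1})} = F - X" by (auto simp: X_def)
    ultimately have "(a * p) * real (card (F - X)) \<le> (a * p) * (a * real (card F))"
      by (simp add: power2_eq_square mult_ac)
    then show ?thesis using ap by (rule mult_left_le_imp_le)
  qed
  have XF: "X \<subseteq> F" by (auto simp: X_def)
  then have cF: "card F = card X + card (F - X)"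
    using finF card_mono[OF finF XF] by (simp add: card_Diff_subset finite_subset)
  have cF0: "0 < real (card F)" using F0 finF by (simp add: card_gt_0_iff)
  have Xlow: "(1 - a) * real (card F) \<le> real (card X)" using lost cF by (simp add: algebra_simps)
  then have X0: "X \<noteq> {}" using cF0 a4 by (auto simp: zero_less_mult_iff mult_le_0_iff)
  have \<Delta>: "real \<Delta> \<le> a * p" using ap by (simp add: \<Delta>_def)
  have D1: "3 * a * p \<le> real D" unfolding D_def by (rule of_nat_ceiling)
  have D2: "real D \<le> 4 * a * p"
  proof -
    have "real D < 3 * a * p + 1" unfolding D_def using ap by linarith
    then show ?thesis using n2 by linarith
  qed
  interpret sparse_family "{1..n}" r X \<Delta> D
  proof
    show "X \<subseteq> {A. A \<subseteq> {1..n} \<and> card A = r}" using XF F by (auto simp: kset_vertices_def)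
    show "card {B \<in> X. card (A \<inter> B) = 1} \<le> \<Delta>" if A: "A \<in> X" for A
    proof -
      have "card {B \<in> X. card (A \<inter> B) = 1} \<le> card {B \<in> F. card (A \<inter> B) = 1}"
        using finF XF by (intro card_mono) auto
      also have "\<dots> \<le> \<Delta>" unfolding \<Delta>_def using A by (intro le_nat_floor) (auto simp: X_def)
      finally show ?thesis .
    qed
    have "real (\<Delta> + r * card {1..n} ^ (r - 4)) < real D"
      using \<Delta> n1 D1 ap by simp
    then show "\<Delta> + r * card {1..n} ^ (r - 4) < D" by (simp only: of_nat_less_iff)
  qed (use r in auto)
  obtain x y q where xy: "x \<in> {1..n}" "y \<in> {1..n}" "x \<noteq> y" and q: "q \<le> card {1..n}"
    and b1: "?f * real (card X) \<le> ?f * real err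
      + real (card {1..n}) * max (real q ^ (r - 3)) (real (card {1..n}) ^ (r - 3) / 4)"
    and b2: "real (card {A \<in> X. \<not> {x, y} \<subseteq> A}) \<le> real err + real (card {1..n} - q) * real (card {1..n}) ^ (r - 3)"
    by (rule pair_structure[OF X0])
  have n0: "0 < real n" using xy by auto
  have np: "0 < real n * p" using n0 p0 by simp
  have err: "real err \<le> 6 * real r ^ 2 * a * (real n * p)"
  proof -
    have "real bad_bound = real r * real \<Delta> + real r ^ 2 * real D" by (simp add: bad_bound_def)
    also have "\<dots> \<le> real r * (a * p) + real r ^ 2 * (4 * a * p)"
      using \<Delta> D2 by (intro add_mono mult_left_mono) auto
    also have "real r * (a * p) \<le> real r ^ 2 * (a * p)"
      using r0 ap by (intro mult_right_mono) (auto simp: power2_eq_square)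
    finally have bad_bound: "real bad_bound \<le> 5 * real r ^ 2 * a * p" by (simp add: mult_ac)
    have nE: "real n * real bad_bound \<le> real n * (5 * real r ^ 2 * a * p)"
      using bad_bound by (intro mult_left_mono) auto
    have cX: "real (card X) \<le> 2 * (real n * p)" using upper cF by simp
    \<comment> \<open>The quadratic bound would give a term of order \<open>n ^ (r - 2)\<close>
      without the small factor \<open>a\<close>; double counting gives \<open>num_rich\<close>
      linear in \<open>n\<close>.\<close>
    have "real (num_rich * D) \<le> real (r ^ 3 * card X)" using num_rich_mult_D by (simp only: of_nat_le_iff)
    then have "real num_rich * real D \<le> real r ^ 3 * real (card X)" by simp
    also have "\<dots> \<le> real r ^ 3 * (2 * (real n * p))" using cX by (intro mult_left_mono) auto
    finally have "real num_rich * real D \<le> 2 * real r ^ 3 * real n * p" by simp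
    moreover have "real num_rich * (a * p) \<le> real num_rich * real D"
      using D1 ap by (intro mult_left_mono) auto
    ultimately have "(real num_rich * a) * p \<le> (2 * real r ^ 3 * real n) * p" by simp
    then have "real num_rich * a \<le> 2 * real r ^ 3 * real n" using p0 by (rule mult_right_le_imp_le)
    then have num_rich: "real num_rich \<le> 2 * real r ^ 3 / a * real n" using a by (simp add: field_simps)
    have pn: "p = real n * real n ^ (r - 4)" by (simp add: p_def r2(2))
    have "7 * real num_rich * real n ^ (r - 4) \<le> 7 * (2 * real r ^ 3 / a * real n) * real n ^ (r - 4)"
      using num_rich by (intro mult_right_mono mult_left_mono) auto
    also have "\<dots> = 14 * real r ^ 3 / a * p" by (simp add: pn)
    finally have Rn: "7 * real num_rich * real n ^ (r - 4) \<le> 14 * real r ^ 3 / a * p" .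
    have "real err = real n * real bad_bound + 7 * real num_rich * real n ^ (r - 4) + p"
      unfolding err_def p_def by simp
    also have "\<dots> \<le> real n * (5 * real r ^ 2 * a * p) + (14 * real r ^ 3 / a + 1) * p"
      using nE Rn by (simp add: distrib_right)
    also have "(14 * real r ^ 3 / a + 1) * p \<le> (real r ^ 2 * a * real n) * p"
      using n3 p0 by (intro mult_right_mono) auto
    finally show ?thesis by (simp add: mult_ac)
  qed
  define \<eta> where "\<eta> = (2 + 6 * ?f * real r ^ 2) * a"
  have max: "(1 - \<eta>) * p \<le> max (real q ^ (r - 3)) (p / 4)"
  proof -
    have "(1 - 2 * a) * (real n * p) \<le> (1 - a) * ((1 - a) * (real n * p))"
    proof -
      have "0 \<le> a * a * (real n * p)" using np by simp
      then show ?thesis by (simp add: algebra_simps)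
    qed
    also have "\<dots> \<le> (1 - a) * (?f * real (card F))" using lower a4 by (intro mult_left_mono) auto
    also have "\<dots> = ?f * ((1 - a) * real (card F))" by simp
    also have "\<dots> \<le> ?f * real (card X)" using Xlow by (intro mult_left_mono) auto
    also have "\<dots> \<le> ?f * real err + real n * max (real q ^ (r - 3)) (p / 4)"
      using b1 by (simp add: p_def)
    also have "?f * real err \<le> ?f * (6 * real r ^ 2 * a * (real n * p))"
      using err by (intro mult_left_mono) auto
    finally have "real n * ((1 - \<eta>) * p) \<le> real n * max (real q ^ (r - 3)) (p / 4)"
      by (simp add: \<eta>_def algebra_simps)
    then show ?thesis using n0 by (rule mult_left_le_imp_le)
  qed
  have "\<eta> \<le> 1 / 2" using small by (simp add: \<eta>_def)
  then have "p / 4 < (1 - \<eta>) * p" using mult_right_mono[of "1/2" "1 - \<eta>" p] p0 by simp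
  then have "(1 - \<eta>) * p \<le> real q ^ (r - 3)" using max by (auto simp: max_def split: if_splits)
  then have "real n * ((1 - \<eta>) * p) \<le> real n * real q ^ (r - 3)" by (intro mult_left_mono) auto
  also have "\<dots> = real q * (real n * real q ^ (r - 4))" by (simp add: r2(2))
  also have "\<dots> \<le> real q * (real n * real n ^ (r - 4))"
    using q by (intro mult_left_mono power_mono) auto
  also have "\<dots> = real q * p" by (simp add: p_def r2(2))
  finally have "((1 - \<eta>) * real n) * p \<le> real q * p" by (simp add: mult_ac)
  then have "(1 - \<eta>) * real n \<le> real q" using p0 by (rule mult_right_le_imp_le)
  then have "real (card {1..n} - q) \<le> \<eta> * real n" using q by (simp add: of_nat_diff algebra_simps)
  then have "real (card {1..n} - q) * p \<le> \<eta> * real n * p" using p0 by (intro mult_right_mono) auto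
  then have XS: "real (card {A \<in> X. \<not> {x, y} \<subseteq> A}) \<le> 6 * real r ^ 2 * a * (real n * p) + \<eta> * (real n * p)"
    using b2 err by (simp add: p_def)
  have "card (F - star n r x y) \<le> card ((F - X) \<union> {A \<in> X. \<not> {x, y} \<subseteq> A})"
    using finF XF F by (intro card_mono) (auto simp: star_def finite_subset)
  also have "\<dots> \<le> card (F - X) + card {A \<in> X. \<not> {x, y} \<subseteq> A}" by (rule card_Un_le)
  finally have "real (card (F - star n r x y)) \<le> real (card (F - X)) + real (card {A \<in> X. \<not> {x, y} \<subseteq> A})"
    by simp
  also have "\<dots> \<le> a * real (card F) + (6 * real r ^ 2 * a * (real n * p) + \<eta> * (real n * p))"
    using lost XS by simp
  also have "a * real (card F) \<le> a * (2 * (real n * p))" using upper a by (intro mult_left_mono) auto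
  also have "6 * real r ^ 2 * a * (real n * p) \<le> 6 * ?f * real r ^ 2 * a * (real n * p)"
    using f1 a np by (intro mult_right_mono) auto
  finally have "real (card (F - star n r x y)) \<le> (4 + 12 * ?f * real r ^ 2) * a * (real n * p)"
    by (simp add: \<eta>_def algebra_simps)
  then show ?thesis using xy by blast
qed

text \<open>The deterministic core: one set more than a star forces one of three surpluses of edges,
  each excluded with high probability. The arguments behind it allow \<open>p = n ^ (r - 3)\<close>
  per set; the weaker rate \<open>n\<close> is common to all \<open>r\<close> and enough for the
  union bound.\<close>

lemma many_cross_pairs:
  assumes r: "4 \<le> r"
  shows "\<exists>\<delta>>0. \<exists>n0. \<forall>n\<ge>n0. \<forall>F\<subseteq>kset_vertices n r.
    card F = Suc ((n - 2) choose (r - 2)) \<longrightarrow>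
      \<delta> * real n * real (card F) < real (card (cross_pairs F F)) \<or>
      (\<exists>x\<in>{1..n}. \<exists>y\<in>{1..n}. \<exists>S. S = star n r x y \<and> F - S \<noteq> {} \<and> card (S - F) \<le> card (F - S) \<and>
        (\<delta> * real n * real (card (F - S)) < real (card (cross_pairs (F - S) (F - S))) \<or>
         \<delta> * real n * real (card (F - S)) < real (card (cross_pairs (F - S) (S \<inter> F)))))"
proof -
  define f where "f = (fact (r - 2) :: real)"
  \<comment> \<open>Half of \<open>1 / fact (r - 2)\<close> serves both shifted binomials, since
    \<open>fact (r - 3)\<close> is not larger than \<open>fact (r - 2)\<close>.\<close>
  define c0 where "c0 = 1 / (2 * f)"
  define C where "C = real (r + 2 * r ^ 2 + r ^ 3 + 23)"
  define \<epsilon> where "\<epsilon> = c0 ^ 2 / (32 * real r ^ 2 * C)"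
  define \<delta>1 where "\<delta>1 = c0 / (32 * real r * C)"
  \<comment> \<open>The first bound makes the distance to the star at most
    \<open>\<epsilon> * n * p\<close>, the second is the smallness condition of
    \<open>star_stability_aux\<close>. The \<open>a ^ 2\<close> in \<open>\<delta>\<close> is the
    average degree allowed there.\<close>
  define a where "a = min (\<epsilon> / (4 + 12 * f * real r ^ 2)) (1 / (2 * (2 + 6 * f * real r ^ 2)))"
  define \<delta> where "\<delta> = min \<delta>1 (a ^ 2)"
  \<comment> \<open>Sum of the lower bounds on \<open>n\<close> required below; the summand 1 makes
    the first of them strict.\<close>
  define K where "K = real r / a + 1 + 1 / a + (14 * real r ^ 3 / a + 1) / (real r ^ 2 * a)"
  have f1: "1 \<le> f" unfolding f_def by (rule fact_ge_1)
  have r0: "4 \<le> real r" using r by simp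
  have C1: "1 \<le> C" by (simp add: C_def)
  have c0: "0 < c0" "c0 \<le> 1" using f1 by (auto simp: c0_def)
  have \<epsilon>0: "0 < \<epsilon>" "0 < \<delta>1" using c0 C1 r0 by (auto simp: \<epsilon>_def \<delta>1_def)
  have fr: "0 < 4 + 12 * f * real r ^ 2" "0 < 2 + 6 * f * real r ^ 2" using f1 by (auto intro!: add_pos_nonneg)
  have a0: "0 < a" using \<epsilon>0 fr by (simp add: a_def)
  have a1: "(4 + 12 * f * real r ^ 2) * a \<le> \<epsilon>"
    using fr mult_left_mono[of a "\<epsilon> / (4 + 12 * f * real r ^ 2)" "4 + 12 * f * real r ^ 2"] by (simp add: a_def)
  have a2: "(2 + 6 * f * real r ^ 2) * a \<le> 1 / 2"
  proof -
    define b where "b = 2 + 6 * f * real r ^ 2"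
    have "a \<le> 1 / (2 * b)" "0 < b" using fr by (simp_all add: a_def b_def)
    then have "b * a \<le> 1 / 2" by (simp add: field_simps)
    then show ?thesis by (simp add: b_def)
  qed
  have \<delta>0: "0 < \<delta>" using \<epsilon>0 a0 by (simp add: \<delta>_def)
  obtain N1 where N1: "\<And>n. N1 \<le> n \<Longrightarrow> (1 - 1 / 2) * real n ^ (r - 2) \<le> fact (r - 2) * real ((n - (r + 1)) choose (r - 2))"
    using binomial_shift_lower[of "1 / 2" "r - 2" "r + 1"] by auto
  obtain N2 where N2: "\<And>n. N2 \<le> n \<Longrightarrow> (1 - 1 / 2) * real n ^ (r - 3) \<le> fact (r - 3) * real ((n - (r + 2)) choose (r - 3))"
    using binomial_shift_lower[of "1 / 2" "r - 3" "r + 2"] by auto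
  obtain N3 where N3: "\<And>n. N3 \<le> n \<Longrightarrow> (1 - a) * real n ^ (r - 2) \<le> fact (r - 2) * real ((n - 2) choose (r - 2))"
    using binomial_shift_lower[of a "r - 2" 2] a0 by auto
  define n0 where "n0 = N1 + N2 + N3 + nat \<lceil>K\<rceil> + 1"
  have main: "(\<exists>x\<in>{1..n}. \<exists>y\<in>{1..n}. \<exists>S. S = star n r x y \<and> F - S \<noteq> {} \<and> card (S - F) \<le> card (F - S) \<and>
        (\<delta> * real n * real (card (F - S)) < real (card (cross_pairs (F - S) (F - S))) \<or>
         \<delta> * real n * real (card (F - S)) < real (card (cross_pairs (F - S) (S \<inter> F)))))"
    if n: "n0 \<le> n" and F: "F \<subseteq> kset_vertices n r" and cF: "card F = Suc ((n - 2) choose (r - 2))"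
      and no: "\<not> \<delta> * real n * real (card F) < real (card (cross_pairs F F))" for n F
  proof -
    define p where "p = real n ^ (r - 3)"
    have nK: "K \<le> real n" using n unfolding n0_def by linarith
    have nn: "1 \<le> real n" using n by (simp add: n0_def)
    have finF: "finite F" using F finite_kset_vertices finite_subset by blast
    have r2: "r - 2 = Suc (r - 3)" "r - 3 = Suc (r - 4)" using r by auto
    have np: "real n ^ (r - 2) = real n * p" by (simp add: p_def r2(1))
    have p1: "real n \<le> p" using nn by (simp add: p_def r2(2) mult_le_cancel_left1)
    have p0: "0 < p" using p1 nn by linarith
    have parts: "0 \<le> real r / a" "0 \<le> 1 / a" "0 \<le> (14 * real r ^ 3 / a + 1) / (real r ^ 2 * a)"
      using a0 by auto
    have "real r / a < real n" "1 / a \<le> real n" "(14 * real r ^ 3 / a + 1) / (real r ^ 2 * a) \<le> real n"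
      using nK parts unfolding K_def by linarith+
    then have big: "real r < a * real n" "1 \<le> a * real n" "14 * real r ^ 3 / a + 1 \<le> real r ^ 2 * a * real n"
      using a0 r0 by (auto simp: divide_less_eq divide_le_eq mult_ac)
    have tau: "\<delta> * real n * real (card Z) \<le> t * p * real (card Z)" if "\<delta> \<le> t" for Z :: "nat set set" and t
      using that \<delta>0 p1 nn by (intro mult_right_mono mult_mono) auto
    have "\<exists>x\<in>{1..n}. \<exists>y\<in>{1..n}. x \<noteq> y \<and>
      real (card (F - star n r x y)) \<le> (4 + 12 * fact (r - 2) * real r ^ 2) * a * (real n * real n ^ (r - 3))"
    proof (rule star_stability_aux[OF r F])
      show "F \<noteq> {}" using cF by auto
      show "0 < a" by (rule a0)
      show "(2 + 6 * fact (r - 2) * real r ^ 2) * a \<le> 1 / 2" using a2 by (simp add: f_def)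
      have "fact (r - 2) * real ((n - 2) choose (r - 2)) \<le> fact (r - 2) * real (card F)"
        using cF by (intro mult_left_mono) auto
      moreover have "(1 - a) * (real n * p) \<le> fact (r - 2) * real ((n - 2) choose (r - 2))"
        using N3[of n] n unfolding np by (simp add: n0_def)
      ultimately show "(1 - a) * (real n * real n ^ (r - 3)) \<le> fact (r - 2) * real (card F)"
        unfolding p_def by linarith
      have "(n - 2) choose (r - 2) \<le> n ^ (r - 2)"
        using binomial_le_power[of "n - 2" "r - 2"] power_mono[of "n - 2" n "r - 2"] by linarith
      then have "real ((n - 2) choose (r - 2)) \<le> real n ^ (r - 2)" by (metis of_nat_le_iff of_nat_power)
      moreover have "1 \<le> real n ^ (r - 2)" using nn by (rule one_le_power)
      ultimately show "real (card F) \<le> 2 * (real n * real n ^ (r - 3))"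
        using cF np by (simp add: p_def)
      show "real (card (cross_pairs F F)) \<le> a ^ 2 * real n ^ (r - 3) * real (card F)"
        using no tau[of "a ^ 2" F] by (simp add: \<delta>_def p_def)
      have "real r * real n ^ (r - 4) < (a * real n) * real n ^ (r - 4)"
        using big(1) nn by (intro mult_strict_right_mono) auto
      then show "real r * real n ^ (r - 4) < a * real n ^ (r - 3)" by (simp add: r2(2))
      show "1 \<le> a * real n ^ (r - 3)"
        using big(2) mult_left_mono[OF p1, of a] a0 unfolding p_def by linarith
      show "14 * real r ^ 3 / a + 1 \<le> real r ^ 2 * a * real n" by (rule big(3))
    qed
    then obtain x y where xy: "x \<in> {1..n}" "y \<in> {1..n}" "x \<noteq> y"
      and close: "real (card (F - star n r x y)) \<le> (4 + 12 * f * real r ^ 2) * a * (real n * p)"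
      by (auto simp: f_def p_def)
    have small: "real (card (F - star n r x y)) \<le> \<epsilon> * (real n * p)"
      using close mult_right_mono[OF a1, of "real n * p"] p0 by simp
    let ?S = "star n r x y"
    have cS: "card ?S = (n - 2) choose (r - 2)" by (rule card_star) (use xy r in auto)
    have "card F = card (F \<inter> ?S) + card (F - ?S)" by (rule card_Int_Diff[OF finF])
    moreover have "card ?S = card (?S \<inter> F) + card (?S - F)" by (rule card_Int_Diff[OF finite_star])
    moreover have "F \<inter> ?S = ?S \<inter> F" by (rule Int_commute)
    \<comment> \<open>Strict because \<open>F\<close> has exactly one set more than the star; in
      particular \<open>F\<close> leaves the star.\<close>
    ultimately have lt: "card (?S - F) < card (F - ?S)" using cF cS by simp
    then have "card (F - ?S) \<noteq> 0" by linarith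
    then have ne: "F - ?S \<noteq> {}" by (metis card.empty)
    show "\<exists>x\<in>{1..n}. \<exists>y\<in>{1..n}. \<exists>S. S = star n r x y \<and> F - S \<noteq> {} \<and> card (S - F) \<le> card (F - S) \<and>
        (\<delta> * real n * real (card (F - S)) < real (card (cross_pairs (F - S) (F - S))) \<or>
         \<delta> * real n * real (card (F - S)) < real (card (cross_pairs (F - S) (S \<inter> F))))"
    proof (intro bexI exI conjI)
      show "?S = star n r x y" ..
      show "F - ?S \<noteq> {}" by (rule ne)
      show "card (?S - F) \<le> card (F - ?S)" using lt by simp
      show "\<delta> * real n * real (card (F - ?S)) < real (card (cross_pairs (F - ?S) (F - ?S))) \<or>
         \<delta> * real n * real (card (F - ?S)) < real (card (cross_pairs (F - ?S) (?S \<inter> F)))"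
      proof (rule ccontr)
        assume c: "\<not> ?thesis"
        show False
        proof (rule near_star_contradiction[OF r F xy c0 C_def \<delta>1_def \<epsilon>_def _ _ ne _ small[unfolded p_def]])
          have "fact (r - 3) \<le> f" unfolding f_def by (intro fact_mono) simp
          then have "fact (r - 3) * real ((n - (r + 2)) choose (r - 3)) \<le> f * real ((n - (r + 2)) choose (r - 3))"
            by (intro mult_right_mono) auto
          then have "1 / 2 * p \<le> f * real ((n - (r + 2)) choose (r - 3))"
            using N2[of n] n by (simp add: n0_def p_def)
          then show "c0 * real n ^ (r - 3) \<le> real ((n - (r + 2)) choose (r - 3))"
            using f1 by (simp add: c0_def p_def field_simps)
          have "1 / 2 * (real n * p) \<le> f * real ((n - (r + 1)) choose (r - 2))"
            using N1[of n] n np by (simp add: n0_def f_def)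
          then show "c0 * (real n * real n ^ (r - 3)) \<le> real ((n - (r + 1)) choose (r - 2))"
            using f1 by (simp add: c0_def p_def field_simps)
          show "card (?S - F) \<le> card (F - ?S)" using lt by simp
          show "real (card (cross_pairs (F - ?S) (F - ?S))) \<le> \<delta>1 * real n ^ (r - 3) * real (card (F - ?S))"
            using c tau[of \<delta>1 "F - ?S"] by (simp add: \<delta>_def p_def)
          show "real (card (cross_pairs (F - ?S) (?S \<inter> F))) \<le> \<delta>1 * real n ^ (r - 3) * real (card (F - ?S))"
            using c tau[of \<delta>1 "F - ?S"] by (simp add: \<delta>_def p_def)
        qed
      qed
    qed (use xy in auto)
  qed
  show ?thesis using \<delta>0 main by blast
qed

lemma finite_kset_edges: "finite (kset_edges n r)"
  by (rule finite_subset[of _ "Pow (kset_vertices n r)"])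
    (auto simp: kset_edges_def finite_kset_vertices)

section \<open>The random subgraph\<close>

definition no_edge :: "(nat set set \<Rightarrow> bool) \<Rightarrow> nat set set \<Rightarrow> nat set set \<Rightarrow> bool" where
  "no_edge \<omega> X Y \<longleftrightarrow> (\<forall>(A, B)\<in>cross_pairs X Y. \<not> \<omega> {A, B})"

lemma cross_pairs_edges:
  assumes "2 \<le> r" "X \<subseteq> kset_vertices n r" "Y \<subseteq> kset_vertices n r" "(A, B) \<in> cross_pairs X Y"
  shows "{A, B} \<in> kset_edges n r"
proof -
  have AB: "A \<in> kset_vertices n r" "B \<in> kset_vertices n r" "card (A \<inter> B) = 1"
    using assms by (auto simp: cross_pairs_def)
  then have "A \<noteq> B" using assms(1) by (auto simp: kset_vertices_def)
  then show ?thesis using AB unfolding kset_edges_def by blast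
qed

lemma card_cross_pairs_le:
  assumes "finite X" "finite Y"
  shows "card (cross_pairs X Y) \<le> 2 * card ((\<lambda>(A, B). {A, B}) ` cross_pairs X Y)"
proof -
  have fin: "finite (cross_pairs X Y)" using assms by (auto simp: cross_pairs_def)
  let ?I = "(\<lambda>(A, B). {A, B}) ` cross_pairs X Y"
  have "card (cross_pairs X Y) \<le> card ?I * 2"
  proof (rule card_le_of_cover[where f = "\<lambda>e. {(A, B) \<in> cross_pairs X Y. {A, B} = e}"])
    show "finite ?I" using fin by simp
    show "cross_pairs X Y \<subseteq> (\<Union>e\<in>?I. {(A, B) \<in> cross_pairs X Y. {A, B} = e})" by auto
    fix e assume "e \<in> ?I"
    then obtain A B where e: "e = {A, B}" by auto
    show "finite {(A, B) \<in> cross_pairs X Y. {A, B} = e}" by (rule finite_subset[OF _ fin]) auto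
    have "{(A', B') \<in> cross_pairs X Y. {A', B'} = e} \<subseteq> {(A, B), (B, A)}" by (auto simp: e doubleton_eq_iff)
    then have "card {(A', B') \<in> cross_pairs X Y. {A', B'} = e} \<le> card {(A, B), (B, A)}"
      by (intro card_mono) auto
    also have "\<dots> \<le> 2" using card_length[of "[(A, B), (B, A)]"] by simp
    finally show "card {(A, B) \<in> cross_pairs X Y. {A, B} = e} \<le> 2" .
  qed
  then show ?thesis by simp
qed

lemma prob_none_kept:
  assumes "E \<subseteq> kset_edges n r"
  shows "measure_pmf.prob (half_random_edges n r) {\<omega>. \<forall>e\<in>E. \<not> \<omega> e} = (1 / 2) ^ card E"
proof -
  let ?B = "\<lambda>e. if e \<in> E then {False} else UNIV"
  have "{\<omega>. \<forall>e\<in>E. \<not> \<omega> e} = Pi (kset_edges n r) ?B"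
    using assms by (auto simp: Pi_def)
  then have "measure_pmf.prob (half_random_edges n r) {\<omega>. \<forall>e\<in>E. \<not> \<omega> e}
      = (\<Prod>e\<in>kset_edges n r. measure_pmf.prob (bernoulli_pmf (1 / 2)) (?B e))"
    unfolding half_random_edges_def by (simp add: measure_Pi_pmf_Pi finite_kset_edges)
  also have "\<dots> = (\<Prod>e\<in>kset_edges n r. if e \<in> E then 1 / 2 else 1)"
    by (intro prod.cong) (auto simp: measure_pmf_single)
  also have "\<dots> = (\<Prod>e\<in>E. 1 / 2)"
    using assms finite_kset_edges by (subst prod.If_cases) (auto simp: Int_absorb1)
  finally show ?thesis by simp
qed

text \<open>More than \<open>t * card X / 2\<close> distinct edges must be absent, as an edge
  accounts for at most two ordered pairs. The exponent is written with \<open>2 * card X\<close> so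
  that half of it can pay for a second family of size at most \<open>card X\<close>.\<close>

lemma prob_no_edge_le:
  assumes r: "2 \<le> r" and X: "X \<subseteq> kset_vertices n r" and Y: "Y \<subseteq> kset_vertices n r"
    and t: "t * real (card X) < real (card (cross_pairs X Y))"
  shows "measure_pmf.prob (half_random_edges n r) {\<omega>. no_edge \<omega> X Y} \<le> (2 powr (- t / 4)) ^ (2 * card X)"
proof -
  let ?E = "(\<lambda>(A, B). {A, B}) ` cross_pairs X Y"
  have fin: "finite X" "finite Y" using X Y finite_kset_vertices finite_subset by blast+
  have eq: "{\<omega>. no_edge \<omega> X Y} = {\<omega>. \<forall>e\<in>?E. \<not> \<omega> e}" by (auto simp: no_edge_def)
  have sub: "?E \<subseteq> kset_edges n r" using cross_pairs_edges[OF r X Y] by auto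
  have "measure_pmf.prob (half_random_edges n r) {\<omega>. no_edge \<omega> X Y} = (1 / 2) ^ card ?E"
    unfolding eq by (rule prob_none_kept[OF sub])
  also have "\<dots> = 2 powr (- real (card ?E))"
    by (simp add: powr_minus powr_realpow power_divide field_simps)
  also have "\<dots> \<le> 2 powr ((- t / 4) * real (2 * card X))"
  proof -
    have "real (card (cross_pairs X Y)) \<le> real (2 * card ?E)"
      using card_cross_pairs_le[OF fin] by (simp only: of_nat_le_iff)
    then show ?thesis using t by (intro powr_mono) auto
  qed
  also have "\<dots> = (2 powr (- t / 4)) ^ (2 * card X)"
    unfolding powr_powr[symmetric] by (rule powr_realpow) simp
  finally show ?thesis .
qed

section \<open>Union bounds\<close>

text \<open>The binomial theorem over subsets; it evaluates the union bound over families of all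
  sizes at once.\<close>

lemma sum_power_card_Pow:
  fixes y :: real
  assumes "finite V"
  shows "(\<Sum>X\<in>Pow V. y ^ card X) = (1 + y) ^ card V"
  using assms
proof (induction V rule: finite_induct)
  case (insert v V)
  have "(\<Sum>X\<in>Pow (insert v V). y ^ card X) = (\<Sum>X\<in>Pow V. y ^ card X) + (\<Sum>X\<in>insert v ` Pow V. y ^ card X)"
    unfolding Pow_insert using insert by (intro sum.union_disjoint) auto
  also have "(\<Sum>X\<in>insert v ` Pow V. y ^ card X) = (\<Sum>X\<in>Pow V. y ^ card (insert v X))"
    using insert by (intro sum.reindex[unfolded o_def]) (auto simp: inj_on_def)
  also have "\<dots> = (\<Sum>X\<in>Pow V. y * y ^ card X)"
  proof (rule sum.cong[OF refl])
    fix X assume "X \<in> Pow V"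
    then have "finite X" "v \<notin> X" using insert finite_subset[of X V] by auto
    then show "y ^ card (insert v X) = y * y ^ card X" by simp
  qed
  also have "\<dots> = y * (1 + y) ^ card V" using insert by (simp add: sum_distrib_left[symmetric])
  finally show ?case using insert by (simp add: algebra_simps)
qed simp

definition sparse_event :: "real \<Rightarrow> nat \<Rightarrow> nat \<Rightarrow> (nat set set \<Rightarrow> bool) set" where
  "sparse_event \<delta> n r = {\<omega>. \<exists>X\<subseteq>kset_vertices n r. X \<noteq> {} \<and>
     \<delta> * real n * real (card X) < real (card (cross_pairs X X)) \<and> no_edge \<omega> X X}"

text \<open>\<open>M\<close> stands for the part of the star missing from an independent family and \<open>X\<close> for the part of
  the family outside the star; \<open>card M \<le> card X\<close> makes the number of choices affordable.\<close>

definition star_event :: "real \<Rightarrow> nat \<Rightarrow> nat \<Rightarrow> (nat set set \<Rightarrow> bool) set" where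
  "star_event \<delta> n r = {\<omega>. \<exists>x\<in>{1..n}. \<exists>y\<in>{1..n}. \<exists>X\<subseteq>kset_vertices n r. \<exists>M\<subseteq>kset_vertices n r.
     X \<noteq> {} \<and> card M \<le> card X \<and>
     \<delta> * real n * real (card X) < real (card (cross_pairs X (star n r x y - M))) \<and>
     no_edge \<omega> X (star n r x y - M)}"

lemma measure_pmf_UN_le:
  assumes "finite I"
  shows "measure_pmf.prob p (\<Union>i\<in>I. f i) \<le> (\<Sum>i\<in>I. measure_pmf.prob p (f i))"
  using assms by (intro measure_pmf.finite_measure_subadditive_finite) auto

context
  fixes n r :: nat and \<delta> y :: real
  assumes r: "2 \<le> r" and \<delta>: "0 < \<delta>"
  defines "y \<equiv> 2 powr (- (\<delta> * real n) / 4)"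
begin

lemma y01: "0 < y" "y \<le> 1"
proof -
  have "2 powr (- (\<delta> * real n) / 4) \<le> 2 powr (0 :: real)" using \<delta> by (intro powr_mono) auto
  then show "y \<le> 1" by (simp add: y_def)
qed (simp add: y_def)

lemma sum_nonempty:
  "(\<Sum>X\<in>Pow (kset_vertices n r) - {{}}. y ^ card X) = (1 + y) ^ card (kset_vertices n r) - 1"
  using sum_power_card_Pow[OF finite_kset_vertices, of y n r]
  by (subst sum_diff1) (auto simp: finite_kset_vertices)

lemma prob_sparse_event:
  "measure_pmf.prob (half_random_edges n r) (sparse_event \<delta> n r)
     \<le> (1 + y) ^ card (kset_vertices n r) - 1"
proof -
  let ?P = "measure_pmf.prob (half_random_edges n r)"
  let ?I = "Pow (kset_vertices n r) - {{}}"
  let ?f = "\<lambda>X. if \<delta> * real n * real (card X) < real (card (cross_pairs X X)) then {\<omega>. no_edge \<omega> X X} else {}"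
  have "?P (sparse_event \<delta> n r) \<le> ?P (\<Union>X\<in>?I. ?f X)"
    by (intro measure_pmf.finite_measure_mono) (auto simp: sparse_event_def)
  also have "\<dots> \<le> (\<Sum>X\<in>?I. ?P (?f X))" by (rule measure_pmf_UN_le) (simp add: finite_kset_vertices)
  also have "\<dots> \<le> (\<Sum>X\<in>?I. y ^ card X)"
  proof (rule sum_mono)
    fix X assume X: "X \<in> ?I"
    show "?P (?f X) \<le> y ^ card X"
    proof (cases "\<delta> * real n * real (card X) < real (card (cross_pairs X X))")
      case True
      then have "?P {\<omega>. no_edge \<omega> X X} \<le> y ^ (2 * card X)"
        unfolding y_def using X by (intro prob_no_edge_le r) auto
      also have "\<dots> \<le> y ^ card X" using y01 by (intro power_decreasing) auto
      finally show ?thesis using True by simp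
    qed (use y01 in simp)
  qed
  also have "\<dots> = (1 + y) ^ card (kset_vertices n r) - 1" by (rule sum_nonempty)
  finally show ?thesis .
qed

lemma prob_star_event:
  "measure_pmf.prob (half_random_edges n r) (star_event \<delta> n r)
     \<le> real n ^ 2 * (((1 + y) ^ card (kset_vertices n r) - 1) * (1 + y) ^ card (kset_vertices n r))"
proof -
  let ?P = "measure_pmf.prob (half_random_edges n r)"
  let ?V = "kset_vertices n r"
  let ?I = "Pow ?V - {{}}"
  let ?J = "({1..n} \<times> {1..n}) \<times> (?I \<times> Pow ?V)"
  let ?f = "\<lambda>((u, v), (X, M)). if card M \<le> card X \<and>
     \<delta> * real n * real (card X) < real (card (cross_pairs X (star n r u v - M)))
     then {\<omega>. no_edge \<omega> X (star n r u v - M)} else {}"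
  have "?P (star_event \<delta> n r) \<le> ?P (\<Union>j\<in>?J. ?f j)"
  proof (intro measure_pmf.finite_measure_mono subsetI)
    fix \<omega> assume "\<omega> \<in> star_event \<delta> n r"
    then obtain u v X M where *: "u \<in> {1..n}" "v \<in> {1..n}" "X \<subseteq> ?V" "M \<subseteq> ?V" "X \<noteq> {}"
      "card M \<le> card X" "\<delta> * real n * real (card X) < real (card (cross_pairs X (star n r u v - M)))"
      "no_edge \<omega> X (star n r u v - M)" unfolding star_event_def by blast
    show "\<omega> \<in> (\<Union>j\<in>?J. ?f j)"
      by (rule UN_I[of "((u, v), (X, M))"]) (use * in auto)
  qed auto
  also have "\<dots> \<le> (\<Sum>j\<in>?J. ?P (?f j))" by (rule measure_pmf_UN_le) (simp add: finite_kset_vertices)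
  also have "\<dots> \<le> (\<Sum>j\<in>?J. (\<lambda>(_, (X, M)). y ^ card X * y ^ card M) j)"
  proof (rule sum_mono)
    fix j assume j: "j \<in> ?J"
    obtain u v X M where [simp]: "j = ((u, v), (X, M))" by (metis surj_pair)
    show "?P (?f j) \<le> (\<lambda>(_, (X, M)). y ^ card X * y ^ card M) j"
    proof (cases "card M \<le> card X \<and> \<delta> * real n * real (card X) < real (card (cross_pairs X (star n r u v - M)))")
      case True
      have "?P {\<omega>. no_edge \<omega> X (star n r u v - M)} \<le> y ^ (2 * card X)"
        unfolding y_def using j True by (intro prob_no_edge_le r) (auto simp: star_def)
      \<comment> \<open>Here \<open>card M \<le> card X\<close> is spent; the sum over
        \<open>X\<close> and \<open>M\<close> then factorises.\<close>
      also have "\<dots> \<le> y ^ (card X + card M)" using y01 True by (intro power_decreasing) auto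
      finally show ?thesis using True by (simp add: power_add)
    qed (use y01 in auto)
  qed
  also have "\<dots> = real n ^ 2 * ((\<Sum>X\<in>?I. y ^ card X) * (\<Sum>M\<in>Pow ?V. y ^ card M))"
    unfolding sum_product sum.cartesian_product by (simp add: sum.cartesian_product[symmetric] power2_eq_square)
  also have "\<dots> = real n ^ 2 * (((1 + y) ^ card ?V - 1) * (1 + y) ^ card ?V)"
    by (simp only: sum_nonempty sum_power_card_Pow[OF finite_kset_vertices])
  finally show ?thesis .
qed

lemma card_kset_vertices_le: "card (kset_vertices n r) \<le> n ^ r"
proof -
  have "card (kset_vertices n r) = n choose r"
    unfolding kset_vertices_def using n_subsets[of "{1..n}" r] by simp
  then show ?thesis using binomial_le_power[of n r] by simp
qed

text \<open>With \<open>w = n ^ r * y\<close>, \<open>(1 + y) ^ card (kset_vertices n r)\<close> is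
  at most \<open>exp w\<close>, hence at most \<open>1 + 2 * w\<close>, so both union bounds become
  linear in \<open>w\<close>.\<close>

lemma prob_events:
  assumes w: "real n ^ r * y \<le> 1"
  shows "measure_pmf.prob (half_random_edges n r) (sparse_event \<delta> n r \<union> star_event \<delta> n r)
     \<le> 6 * (real n ^ 2 + 1) * (real n ^ r * y)"
proof -
  let ?P = "measure_pmf.prob (half_random_edges n r)"
  define w where "w = real n ^ r * y"
  have w01: "0 \<le> w" "w \<le> 1" using assms y01 by (auto simp: w_def)
  let ?v = "card (kset_vertices n r)"
  have "(1 + y) ^ ?v \<le> (1 + y) ^ (n ^ r)"
    using y01 card_kset_vertices_le by (intro power_increasing) auto
  also have "\<dots> \<le> exp y ^ (n ^ r)" using y01 by (intro power_mono exp_ge_add_one_self) auto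
  also have "\<dots> = exp w" by (simp add: exp_of_nat_mult[symmetric] w_def)
  also have "\<dots> \<le> 1 + w + w\<^sup>2" using w01 exp_bound[of w] by simp
  also have "\<dots> \<le> 1 + 2 * w" using w01 mult_left_mono[of w 1 w] by (simp add: power2_eq_square)
  finally have q: "(1 + y) ^ ?v \<le> 1 + 2 * w" .
  have q1: "1 \<le> (1 + y) ^ ?v" using y01 by (intro one_le_power) simp
  have prod: "((1 + y) ^ ?v - 1) * (1 + y) ^ ?v \<le> (2 * w) * 3"
    using q q1 w01 by (intro mult_mono) auto
  have "?P (sparse_event \<delta> n r \<union> star_event \<delta> n r) \<le> ?P (sparse_event \<delta> n r) + ?P (star_event \<delta> n r)"
    by (rule measure_Un_le) auto
  also have "\<dots> \<le> 6 * w + real n ^ 2 * ((2 * w) * 3)"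
  proof (rule add_mono)
    show "?P (sparse_event \<delta> n r) \<le> 6 * w" using prob_sparse_event q w01 by simp
    have "real n ^ 2 * (((1 + y) ^ ?v - 1) * (1 + y) ^ ?v) \<le> real n ^ 2 * ((2 * w) * 3)"
      by (intro mult_left_mono prod) auto
    then show "?P (star_event \<delta> n r) \<le> real n ^ 2 * ((2 * w) * 3)" using prob_star_event by linarith
  qed
  finally show ?thesis by (simp add: w_def algebra_simps)
qed

end

section \<open>Independence numbers and the limit\<close>

lemma indep_num_le:
  assumes "finite V" and "\<And>S. indep_set V F S \<Longrightarrow> card S \<le> N"
  shows "indep_num V F \<le> N"
proof -
  have fin: "finite {card S |S. indep_set V F S}"
    by (rule finite_subset[of _ "card ` Pow V"]) (use assms in \<open>auto simp: indep_set_def\<close>)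
  have ne: "{card S |S. indep_set V F S} \<noteq> {}" by (auto simp: indep_set_def intro!: exI[of _ "{}"])
  show ?thesis unfolding indep_num_def using fin ne assms(2) by (subst Max_le_iff) auto
qed

lemma indep_num_ge:
  assumes "finite V" "indep_set V F S"
  shows "card S \<le> indep_num V F"
proof -
  have fin: "finite {card S |S. indep_set V F S}"
    by (rule finite_subset[of _ "card ` Pow V"]) (use assms in \<open>auto simp: indep_set_def\<close>)
  then show ?thesis unfolding indep_num_def using assms(2) by (intro Max_ge) auto
qed

lemma indep_set_star:
  assumes "x \<noteq> y"
  shows "indep_set (kset_vertices n r) (kset_edges n r) (star n r x y)"
  unfolding indep_set_def
proof (intro conjI ballI notI)
  show "star n r x y \<subseteq> kset_vertices n r" by (auto simp: star_def)
  fix A B assume A: "A \<in> star n r x y" and B: "B \<in> star n r x y" and e: "{A, B} \<in> kset_edges n r"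
  then have "card (A \<inter> B) = 1" by (auto simp: kset_edges_def doubleton_eq_iff Int_commute)
  moreover have "{x, y} \<subseteq> A \<inter> B" using A B by (auto simp: star_def)
  ultimately show False using assms by (metis card_1_singletonE insert_subset singletonD)
qed

lemma no_edge_of_indep:
  assumes r: "2 \<le> r" and F: "indep_set (kset_vertices n r) (kept_edges n r \<omega>) F" and "X \<subseteq> F" "Y \<subseteq> F"
  shows "no_edge \<omega> X Y"
  unfolding no_edge_def
proof (intro ballI, clarify)
  fix A B assume AB: "(A, B) \<in> cross_pairs X Y" and k: "\<omega> {A, B}"
  have "{A, B} \<in> kset_edges n r"
    using assms AB by (intro cross_pairs_edges[OF r]) (auto simp: indep_set_def)
  then have "{A, B} \<in> kept_edges n r \<omega>" using k by (simp add: kept_edges_def)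
  moreover have "A \<in> F" "B \<in> F" using AB assms by (auto simp: cross_pairs_def)
  ultimately show False using F by (auto simp: indep_set_def)
qed

lemma tail_tendsto_0:
  assumes "0 < (\<delta> :: real)"
  shows "(\<lambda>n. 6 * (real n ^ 2 + 1) * (real n ^ r * 2 powr (- (\<delta> * real n) / 4))) \<longlonglongrightarrow> 0"
    "(\<lambda>n. real n ^ r * 2 powr (- (\<delta> * real n) / 4)) \<longlonglongrightarrow> 0"
  using assms by real_asymp+

theorem theorem4:
  fixes r :: nat
  assumes "r \<ge> 4"
  shows "(\<lambda>n. measure_pmf.prob (half_random_edges n r)
            {\<omega>. indep_num (kset_vertices n r) (kept_edges n r \<omega>)
                 = indep_num (kset_vertices n r) (kset_edges n r)})
         \<longlonglongrightarrow> 1"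
proof -
  have r2: "2 \<le> r" using assms by simp
  obtain \<delta> n0 where \<delta>: "0 < \<delta>" and main: "\<forall>n\<ge>n0. \<forall>F\<subseteq>kset_vertices n r.
    card F = Suc ((n - 2) choose (r - 2)) \<longrightarrow>
      \<delta> * real n * real (card F) < real (card (cross_pairs F F)) \<or>
      (\<exists>x\<in>{1..n}. \<exists>y\<in>{1..n}. \<exists>S. S = star n r x y \<and> F - S \<noteq> {} \<and> card (S - F) \<le> card (F - S) \<and>
        (\<delta> * real n * real (card (F - S)) < real (card (cross_pairs (F - S) (F - S))) \<or>
         \<delta> * real n * real (card (F - S)) < real (card (cross_pairs (F - S) (S \<inter> F)))))"
    using many_cross_pairs[OF assms] by (elim exE conjE) (rule that)
  let ?P = "\<lambda>n. measure_pmf.prob (half_random_edges n r)"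
  let ?V = "\<lambda>n. kset_vertices n r"
  let ?G = "\<lambda>n. {\<omega>. indep_num (?V n) (kept_edges n r \<omega>) = indep_num (?V n) (kset_edges n r)}"
  let ?b = "\<lambda>n. 6 * (real n ^ 2 + 1) * (real n ^ r * 2 powr (- (\<delta> * real n) / 4))"
  have good: "\<omega> \<in> ?G n" if n: "n0 + 2 \<le> n" and \<omega>: "\<omega> \<notin> sparse_event \<delta> n r \<union> star_event \<delta> n r" for n \<omega>
  proof -
    let ?N = "(n - 2) choose (r - 2)"
    have le: "card S \<le> ?N" if S: "indep_set (?V n) (kept_edges n r \<omega>) S" for S
    proof (rule ccontr)
      assume "\<not> card S \<le> ?N"
      \<comment> \<open>Subfamilies of independent families are independent, so \<open>S\<close> is
        cut down to the exact size that \<open>many_cross_pairs\<close> asks for.\<close>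
      then obtain F where F: "F \<subseteq> S" "card F = Suc ?N"
        by (meson not_less_eq_eq obtain_subset_with_card_n)
      have FV: "F \<subseteq> ?V n" using F S by (auto simp: indep_set_def)
      have ne: "no_edge \<omega> X Y" if "X \<subseteq> F" "Y \<subseteq> F" for X Y
        using no_edge_of_indep[OF r2 S] that F by blast
      have sp: "\<not> \<delta> * real n * real (card X) < real (card (cross_pairs X X))" if "X \<subseteq> F" "X \<noteq> {}" for X
      proof
        assume big: "\<delta> * real n * real (card X) < real (card (cross_pairs X X))"
        have "\<omega> \<in> sparse_event \<delta> n r"
          unfolding sparse_event_def mem_Collect_eq
          by (rule exI[of _ X]) (intro conjI subset_trans[OF that(1) FV] that(2) big ne that(1))
        then show False using \<omega> by blast
      qed
      have "F \<noteq> {}" using F by auto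
      note nsp = sp[OF order_refl this]
      have "n0 \<le> n" using n by simp
      from main[rule_format, OF this FV F(2)] have ex: "\<exists>x\<in>{1..n}. \<exists>y\<in>{1..n}. \<exists>S. S = star n r x y \<and> F - S \<noteq> {} \<and>
        card (S - F) \<le> card (F - S) \<and>
        (\<delta> * real n * real (card (F - S)) < real (card (cross_pairs (F - S) (F - S))) \<or>
         \<delta> * real n * real (card (F - S)) < real (card (cross_pairs (F - S) (S \<inter> F))))"
        by (rule disjE) (use nsp in simp_all)
      then obtain x y S' where S': "x \<in> {1..n}" "y \<in> {1..n}" "S' = star n r x y"
        "F - S' \<noteq> {}" "card (S' - F) \<le> card (F - S')"
        "\<delta> * real n * real (card (F - S')) < real (card (cross_pairs (F - S') (F - S'))) \<or>
         \<delta> * real n * real (card (F - S')) < real (card (cross_pairs (F - S') (S' \<inter> F)))"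
        by (elim bexE exE conjE) (rule that)
      \<comment> \<open>With \<open>S' - F\<close> in the role of the missing part \<open>M\<close>,
        the star part of \<open>F\<close> takes the form used in \<open>star_event\<close>.\<close>
      have eq: "S' \<inter> F = star n r x y - (S' - F)" unfolding S'(3) by blast
      have big: "\<delta> * real n * real (card (F - S')) < real (card (cross_pairs (F - S') (star n r x y - (S' - F))))"
      proof -
        have "\<delta> * real n * real (card (F - S')) < real (card (cross_pairs (F - S') (S' \<inter> F)))"
          by (rule disjE[OF S'(6)]) (use sp[OF Diff_subset S'(4)] in simp_all)
        then show ?thesis unfolding eq .
      qed
      have none: "no_edge \<omega> (F - S') (star n r x y - (S' - F))"
        unfolding eq[symmetric] by (rule ne) auto
      have sub: "S' - F \<subseteq> ?V n" "F - S' \<subseteq> ?V n" using S'(3) FV by (auto simp: star_def)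
      have "\<omega> \<in> star_event \<delta> n r"
        unfolding star_event_def mem_Collect_eq
        by (rule bexI[OF _ S'(1)], rule bexI[OF _ S'(2)], rule exI[of _ "F - S'"], rule conjI[OF sub(2)],
            rule exI[of _ "S' - F"], intro conjI sub(1) S'(4,5) big none)
      then show False using \<omega> by blast
    qed
    \<comment> \<open>A star attains \<open>?N\<close> in the full graph, and deleting edges cannot
      lower the independence number, so the chain of inequalities closes up.\<close>
    have "indep_num (?V n) (kept_edges n r \<omega>) \<le> ?N"
      by (rule indep_num_le[OF finite_kset_vertices le])
    also have "?N = card (star n r 1 2)" by (rule card_star[symmetric]) (use n r2 in auto)
    also have "\<dots> \<le> indep_num (?V n) (kset_edges n r)"
      by (rule indep_num_ge[OF finite_kset_vertices indep_set_star]) simp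
    finally have 1: "indep_num (?V n) (kept_edges n r \<omega>) \<le> indep_num (?V n) (kset_edges n r)" .
    have "indep_num (?V n) (kset_edges n r) \<le> indep_num (?V n) (kept_edges n r \<omega>)"
    proof (rule indep_num_le[OF finite_kset_vertices])
      fix S assume "indep_set (?V n) (kset_edges n r) S"
      then have "indep_set (?V n) (kept_edges n r \<omega>) S" by (auto simp: indep_set_def kept_edges_def)
      then show "card S \<le> indep_num (?V n) (kept_edges n r \<omega>)"
        by (rule indep_num_ge[OF finite_kset_vertices])
    qed
    with 1 show ?thesis by simp
  qed
  have small: "\<forall>\<^sub>F n in sequentially. real n ^ r * 2 powr (- (\<delta> * real n) / 4) \<le> 1"
    by (rule eventually_mono[OF order_tendstoD(2)[OF tail_tendsto_0(2)[OF \<delta>, of r], of 1]]) auto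
  have lower: "\<forall>\<^sub>F n in sequentially. 1 - ?b n \<le> ?P n (?G n)"
    using small eventually_ge_at_top[of "n0 + 2"]
  proof eventually_elim
    case (elim n)
    let ?B = "sparse_event \<delta> n r \<union> star_event \<delta> n r"
    have "1 - ?b n \<le> 1 - ?P n ?B" using prob_events[OF r2 \<delta> elim(1)] by simp
    also have "\<dots> = ?P n (- ?B)" using measure_pmf.prob_compl[of ?B "half_random_edges n r"] by (simp add: Compl_eq_Diff_UNIV)
    also have "\<dots> \<le> ?P n (?G n)" using good[OF elim(2)] by (intro measure_pmf.finite_measure_mono) auto
    finally show ?case .
  qed
  have "(\<lambda>n. 1 - ?b n) \<longlonglongrightarrow> 1 - 0" by (intro tendsto_intros tail_tendsto_0 \<delta>)
  then have lim: "(\<lambda>n. 1 - ?b n) \<longlonglongrightarrow> 1" by simp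
  show ?thesis by (rule tendsto_sandwich[OF lower _ lim tendsto_const]) simp
qed

end
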